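(* Let $G$ be a cactus graph and let $\ell$ be an integer with $\ell\geq 4$. For every pair of $\ell$-colorings $\alpha$ and $\beta$ of $G$, there is a transformation from $\alpha$ to $\beta$ (through $\ell$-colorings of $G$) in which each vertex of $G$ is recolored at most $3$ times.
   Context: All graphs are finite and simple. A cut vertex of a graph is a vertex whose deletion increases the number of components. A block of a graph $G$ is a maximal subgraph of $G$ that is connected and has no cut vertex (of itself). A cactus graph is a connected planar graph in which every block is either a cycle or an edge. An $\ell$-coloring of $G$ is a proper coloring, i.e. a map $c:V(G)\to\{1,2,\ldots,\ell\}$ such that adjacent vertices receive different colors. The $\ell$-reconfiguration graph $\mathcal{R}_\ell(G)$ has as vertices the $\ell$-colorings of $G$, two colorings being adjacent if they differ in color on exactly one vertex of $G$. A transformation from $\alpha$ to $\beta$ is a path from $\alpha$ to $\beta$ in $\mathcal{R}_\ell(G)$; each edge of the path recolors exactly one vertex of $G$, and the number of times a vertex $v$ is recolored is the number of edges of the path along which the color of $v$ changes. *)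

theory Defs
  imports
    "HOL-Analysis.Analysis"
    "Graph_Theory.Digraph_Component"
begin

text \<open>
  A finite simple graph is an instance of the locale \<^locale>\<open>graph\<close>, where an undirected edge
  is represented by the two opposite arcs between its ends.
\<close>

definition edges :: "('a, 'b) pre_digraph \<Rightarrow> 'a set set" where
  "edges G = {{u, v} | u v. u \<rightarrow>\<^bsub>G\<^esub> v}"

text \<open>Planarity is meant topologically: the graph has a drawing in the plane without crossings.\<close>

definition planar :: "('a, 'b) pre_digraph \<Rightarrow> bool" where
  "planar G \<longleftrightarrow> (\<exists>(\<phi> :: 'a \<Rightarrow> complex) (\<gamma> :: 'a set \<Rightarrow> real \<Rightarrow> complex).
     inj_on \<phi> (verts G) \<and>
     (\<forall>e \<in> edges G. Path_Connected.arc (\<gamma> e) \<and>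
        {pathstart (\<gamma> e), pathfinish (\<gamma> e)} = \<phi> ` e \<and>
        path_image (\<gamma> e) \<inter> \<phi> ` verts G = \<phi> ` e) \<and>
     (\<forall>e \<in> edges G. \<forall>f \<in> edges G. e \<noteq> f \<longrightarrow>
        path_image (\<gamma> e) \<inter> path_image (\<gamma> f) = \<phi> ` (e \<inter> f)))"

text \<open>
  In a symmetric digraph reachability is symmetric, so the strongly connected components
  \<^const>\<open>pre_digraph.sccs\<close> are the connected components of the undirected graph.
\<close>

definition cut_vertex :: "('a, 'b) pre_digraph \<Rightarrow> 'a \<Rightarrow> bool" where
  "cut_vertex G v \<longleftrightarrow> v \<in> verts G \<and>
     card (pre_digraph.sccs G) < card (pre_digraph.sccs (pre_digraph.del_vert G v))"

text \<open>
  The condition \<^term>\<open>graph H\<close> restricts \<^const>\<open>pre_digraph.max_subgraph\<close> to symmetric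
  subdigraphs, that is, to subgraphs in the undirected sense.
\<close>

definition block :: "('a, 'b) pre_digraph \<Rightarrow> ('a, 'b) pre_digraph \<Rightarrow> bool" where
  "block G B \<longleftrightarrow> pre_digraph.max_subgraph G
     (\<lambda>H. graph H \<and> Digraph_Component.connected H \<and> (\<nexists>v. cut_vertex H v)) B"

text \<open>
  \<^const>\<open>pre_digraph.cycle\<close> also accepts \<open>u, v, u\<close> in a symmetric digraph; the length
  bound excludes this.
\<close>

definition cycle_graph :: "('a, 'b) pre_digraph \<Rightarrow> bool" where
  "cycle_graph G \<longleftrightarrow> (\<exists>p. pre_digraph.cycle G p \<and> 3 \<le> length p \<and>
     verts G = tail G ` set p \<and>
     edges G = (\<lambda>a. {tail G a, head G a}) ` set p)"

definition edge_graph :: "('a, 'b) pre_digraph \<Rightarrow> bool" where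
  "edge_graph G \<longleftrightarrow> (\<exists>u v. u \<noteq> v \<and> verts G = {u, v} \<and> edges G = {{u, v}})"

definition cactus :: "('a, 'b) pre_digraph \<Rightarrow> bool" where
  "cactus G \<longleftrightarrow> graph G \<and> Digraph_Component.connected G \<and> planar G \<and>
     (\<forall>B. block G B \<longrightarrow> cycle_graph B \<or> edge_graph B)"

text \<open>Colorings are extensional, so that they are determined by their values on the vertices.\<close>

definition colorings :: "nat \<Rightarrow> ('a, 'b) pre_digraph \<Rightarrow> ('a \<Rightarrow> nat) set" where
  "colorings l G = {c \<in> verts G \<rightarrow>\<^sub>E {1..l}. \<forall>u v. u \<rightarrow>\<^bsub>G\<^esub> v \<longrightarrow> c u \<noteq> c v}"

definition reconf_graph ::
  "nat \<Rightarrow> ('a, 'b) pre_digraph \<Rightarrow> ('a \<Rightarrow> nat, ('a \<Rightarrow> nat) \<times> ('a \<Rightarrow> nat)) pre_digraph" where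
  "reconf_graph l G = with_proj
     \<lparr> pverts = colorings l G,
       parcs = {(c, d). c \<in> colorings l G \<and> d \<in> colorings l G \<and>
                  (\<exists>!v. v \<in> verts G \<and> c v \<noteq> d v)} \<rparr>"

definition transformation ::
  "nat \<Rightarrow> ('a, 'b) pre_digraph \<Rightarrow> ('a \<Rightarrow> nat) \<Rightarrow> (('a \<Rightarrow> nat) \<times> ('a \<Rightarrow> nat)) list \<Rightarrow> ('a \<Rightarrow> nat) \<Rightarrow> bool"
  where
  "transformation l G \<alpha> p \<beta> \<longleftrightarrow> pre_digraph.apath (reconf_graph l G) \<alpha> p \<beta>"

definition times_recolored :: "(('a \<Rightarrow> nat) \<times> ('a \<Rightarrow> nat)) list \<Rightarrow> 'a \<Rightarrow> nat" where
  "times_recolored p v = length (filter (\<lambda>(c, d). c v \<noteq> d v) p)"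

end

theory Submission
  imports Defs
begin

text \<open>
  Call a recoloring step from \<open>f\<close> to \<open>f'\<close> one-shot if every vertex is recolored at most once.
  It can be carried out as soon as the vertices admit a rank such that \<open>x\<close> precedes \<open>y\<close> whenever
  \<open>x\<close> and \<open>y\<close> are adjacent and \<open>f x = f' y\<close>. It therefore suffices to find colorings \<open>g\<close>, \<open>h\<close>
  such that \<open>\<alpha>\<close>, \<open>g\<close>, \<open>h\<close>, \<open>\<beta>\<close> are consecutive one-shot steps.

  These are built block by block, starting at a root. The key is that on a cycle (or an edge) such
  \<open>g\<close> and \<open>h\<close> exist with arbitrarily prescribed colors at one vertex, and that ranks on two pieces
  sharing a single vertex can be glued. The vertex set treated so far is kept such that each
  component of the rest is attached to it at a single vertex; a block entering such a component
  preserves this, because an ear on a block would contradict its maximality.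
\<close>

section \<open>Recoloring a cycle\<close>

text \<open>Old colors \<open>p\<close>, new colors \<open>q\<close>, times \<open>\<rho>\<close>: a
  vertex must give up its color before a neighbor takes it. Two vertices that exchange colors admit
  no such times.\<close>

definition ranked_edge :: "(nat \<Rightarrow> int) \<Rightarrow> (nat \<Rightarrow> nat) \<Rightarrow> (nat \<Rightarrow> nat) \<Rightarrow> nat \<Rightarrow> nat \<Rightarrow> bool" where
  "ranked_edge \<rho> p q i j \<longleftrightarrow> (p i = q j \<longrightarrow> \<rho> i < \<rho> j) \<and> (p j = q i \<longrightarrow> \<rho> j < \<rho> i)"

text \<open>Positions run from 0 to \<open>k\<close>, so the cycle has \<open>k + 1\<close> vertices
  and is closed by the edge from \<open>k\<close> to 0.\<close>

definition cycle_one_shot :: "nat \<Rightarrow> (nat \<Rightarrow> nat) \<Rightarrow> (nat \<Rightarrow> nat) \<Rightarrow> bool" where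
  "cycle_one_shot k p q \<longleftrightarrow> (\<exists>\<rho> :: nat \<Rightarrow> int.
     (\<forall>i<k. ranked_edge \<rho> p q i (Suc i)) \<and> ranked_edge \<rho> p q k 0)"

text \<open>
  If no dependency runs through vertex \<open>0\<close>, then it is a source or a sink of the precedence
  relation and can be ranked first or last; the remaining path has no obstruction but swaps.
\<close>

lemma cycle_one_shotI:
  assumes "2 \<le> k"
    and swap: "\<And>i. i < k \<Longrightarrow> p i = q (Suc i) \<Longrightarrow> p (Suc i) = q i \<Longrightarrow> False"
    and "\<not> (p k = q 0 \<and> p 0 = q k)"
    and "\<not> (p 1 = q 0 \<and> p 0 = q k)" "\<not> (p k = q 0 \<and> p 0 = q 1)"
  shows "cycle_one_shot k p q"
proof -
  \<comment> \<open>Along the path the time increases when position \<open>i\<close> must precede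
    its successor and decreases otherwise. Without swaps this respects all dependencies that avoid
    vertex 0.\<close>
  define \<sigma> where "\<sigma> = rec_nat (0 :: int) (\<lambda>i s. if p i = q (Suc i) then s + 1 else s - 1)"
  have \<sigma>: "\<sigma> (Suc i) = (if p i = q (Suc i) then \<sigma> i + 1 else \<sigma> i - 1)" for i
    by (simp add: \<sigma>_def)
  define \<rho> where "\<rho> = \<sigma>(0 := if p 1 = q 0 \<or> p k = q 0 then max (\<sigma> 1) (\<sigma> k) + 1
                            else min (\<sigma> 1) (\<sigma> k) - 1)"
  have "ranked_edge \<rho> p q i (Suc i)" if "i < k" for i
  proof (cases i)
    case 0
    then show ?thesis
      using assms(1,3-5) swap[OF that] by (auto simp: ranked_edge_def \<rho>_def)
  next
    case (Suc j)
    then show ?thesis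
      using swap[OF that] by (auto simp: ranked_edge_def \<rho>_def \<sigma>)
  qed
  moreover have "ranked_edge \<rho> p q k 0"
    using assms(1,3-5) swap[of 0] by (auto simp: ranked_edge_def \<rho>_def)
  ultimately show ?thesis
    unfolding cycle_one_shot_def by blast
qed

text \<open>The hypotheses exclude the directed 2-cycles and 3-cycles, so the precedence relation is
  acyclic.\<close>

lemma triangle_one_shotI:
  assumes "\<not> (p 0 = q 1 \<and> p 1 = q 0)" "\<not> (p 1 = q 2 \<and> p 2 = q 1)" "\<not> (p 2 = q 0 \<and> p 0 = q 2)"
    and "\<not> (p 0 = q 1 \<and> p 1 = q 2 \<and> p 2 = q 0)" "\<not> (p 1 = q 0 \<and> p 2 = q 1 \<and> p 0 = q 2)"
  shows "cycle_one_shot 2 p q"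
proof -
  \<comment> \<open>Number of predecessors minus number of successors; in an acyclic relation on
    three vertices it increases along every dependency.\<close>
  define \<rho> :: "nat \<Rightarrow> int" where
    "\<rho> i = (\<Sum>j\<in>{0, 1, 2} - {i}. of_bool (p j = q i) - of_bool (p i = q j))" for i
  have d: "{0, 1, 2 :: nat} - {0} = {1, 2}" "{0, 1, 2 :: nat} - {1} = {0, 2}"
      "{0, 1, 2 :: nat} - {2} = {0, 1}"
    by auto
  have "\<rho> 0 = of_bool (p 1 = q 0) - of_bool (p 0 = q 1) + (of_bool (p 2 = q 0) - of_bool (p 0 = q 2))"
      "\<rho> 1 = of_bool (p 0 = q 1) - of_bool (p 1 = q 0) + (of_bool (p 2 = q 1) - of_bool (p 1 = q 2))"
      "\<rho> 2 = of_bool (p 0 = q 2) - of_bool (p 2 = q 0) + (of_bool (p 1 = q 2) - of_bool (p 2 = q 1))"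
    unfolding \<rho>_def d by simp_all
  then have "ranked_edge \<rho> p q 0 1" "ranked_edge \<rho> p q 1 2" "ranked_edge \<rho> p q 2 0"
    unfolding ranked_edge_def using assms by (simp_all add: of_bool_def split: if_splits)
  then have "(\<forall>i<2. ranked_edge \<rho> p q i (Suc i)) \<and> ranked_edge \<rho> p q 2 0"
    by (auto simp: less_Suc_eq numeral_2_eq_2)
  then show ?thesis
    unfolding cycle_one_shot_def by blast
qed

section \<open>Color choices and colorings of paths\<close>

lemma ex_color:
  assumes "4 \<le> card C" "card S \<le> 3" "finite S"
  shows "\<exists>z \<in> C. z \<notin> S"
  using assms card_mono[of S C] by fastforce

lemma ex_color3:
  assumes "4 \<le> card C"
  shows "\<exists>z \<in> C. z \<noteq> p \<and> z \<noteq> q \<and> z \<noteq> r"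
proof -
  have "card {p, q, r} \<le> 3" by (simp add: card_insert_if)
  then show ?thesis using ex_color[OF assms, of "{p, q, r}"] by simp
qed

text \<open>At most three colors are ever forbidden: \<open>b0\<close> matters only if
  \<open>s = b1\<close> and \<open>b2\<close> only if \<open>t = b1\<close>, and when both matter
  \<open>s\<close> and \<open>t\<close> coincide.\<close>

lemma ex_color_between:
  assumes "4 \<le> card C"
  shows "\<exists>z \<in> C. z \<noteq> s \<and> z \<noteq> t \<and> \<not> (s = b1 \<and> z = b0) \<and> \<not> (z = b2 \<and> t = b1)"
proof -
  consider "s \<noteq> b1" | "t \<noteq> b1" "s = b1" | "t = b1" "s = b1" by blast
  then show ?thesis
  proof cases
    case 1
    then show ?thesis using ex_color3[OF assms, of s t b2] by blast
  next
    case 2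
    then show ?thesis using ex_color3[OF assms, of s t b0] by blast
  next
    case 3
    then show ?thesis using ex_color3[OF assms, of s b0 b2] by blast
  qed
qed

text \<open>Greedy from the left: each new color differs from its predecessor and from the
  predecessor's entry in \<open>b\<close>, which excludes a swap. The last inner vertex, facing two
  fixed neighbors, uses \<open>ex_color_between\<close>; hence \<open>2 \<le> n\<close>.\<close>

lemma path_fill:
  fixes b :: "nat \<Rightarrow> nat"
  assumes C: "4 \<le> card C" and "2 \<le> n" "s \<in> C" "t \<in> C"
  shows "\<exists>y. y 0 = s \<and> y n = t \<and> range y \<subseteq> C \<and>
    (\<forall>i<n. y i \<noteq> y (Suc i) \<and> \<not> (y i = b (Suc i) \<and> y (Suc i) = b i))"
  using assms(2,3)
proof (induction n arbitrary: b s rule: dec_induct)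
  case base
  obtain z where z: "z \<in> C" "z \<noteq> s" "z \<noteq> t" "\<not> (s = b 1 \<and> z = b 0)" "\<not> (z = b 2 \<and> t = b 1)"
    using ex_color_between[OF C] by metis
  define y where "y i = (if i = 0 then s else if i = 1 then z else t)" for i :: nat
  have "y 0 = s \<and> y 2 = t \<and> range y \<subseteq> C \<and>
      (\<forall>i<2. y i \<noteq> y (Suc i) \<and> \<not> (y i = b (Suc i) \<and> y (Suc i) = b i))"
    using z \<open>s \<in> C\<close> \<open>t \<in> C\<close> by (auto simp: y_def less_Suc_eq numeral_2_eq_2)
  then show ?case by blast
next
  case (step n)
  obtain z where z: "z \<in> C" "z \<noteq> s" "z \<noteq> b 0"
    using ex_color3[OF C] by metis
  obtain y where y: "y 0 = z" "y n = t" "range y \<subseteq> C"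
      "\<forall>i<n. y i \<noteq> y (Suc i) \<and> \<not> (y i = b (Suc (Suc i)) \<and> y (Suc i) = b (Suc i))"
    using step.IH[OF z(1), of "\<lambda>i. b (Suc i)"] by blast
  have "\<forall>i<Suc n. case_nat s y i \<noteq> case_nat s y (Suc i) \<and>
      \<not> (case_nat s y i = b (Suc i) \<and> case_nat s y (Suc i) = b i)"
    using y z by (auto split: nat.split)
  moreover have "range (case_nat s y) \<subseteq> C"
    using y(3) step.prems by (auto simp: image_subset_iff split: nat.split)
  ultimately show ?case
    using y(2) by (intro exI[of _ "case_nat s y"]) simp
qed

text \<open>Meant for the second colors between the root and the closing vertex of a long cycle:
  \<open>s\<close> and \<open>t\<close> are the root's second and target colors,
  \<open>b (Suc n)\<close> is the target color of the closing vertex.\<close>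

lemma path_coloring:
  fixes b :: "nat \<Rightarrow> nat"
  assumes C: "4 \<le> card C" and b: "\<And>i. i \<le> n \<Longrightarrow> b i \<noteq> b (Suc i)"
  shows "\<exists>y. y 0 \<notin> {s, t} \<and> y n \<notin> {s, t, b (Suc n)} \<and> range y \<subseteq> C \<and>
    (\<forall>i<n. y i \<noteq> y (Suc i) \<and> \<not> (y i = b (Suc i) \<and> y (Suc i) = b i))"
proof -
  obtain z where z: "z \<in> C" "z \<noteq> s" "z \<noteq> t" "z \<noteq> b (Suc n)"
    using ex_color3[OF C] by metis
  consider "n = 0" | "n = 1" | "2 \<le> n" by linarith
  then show ?thesis
  proof cases
    case 1
    then show ?thesis using z by (intro exI[of _ "\<lambda>_. z"]) auto
  next
    case 2
    show ?thesis
    \<comment> \<open>A two-vertex path has no inner vertex for \<open>path_fill\<close>. If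
      admissible, \<open>b 2\<close> goes to the first vertex: it differs from \<open>b 1\<close>,
      so no swap occurs, and the second vertex is kept off it. Otherwise avoiding
      \<open>{s, t}\<close> already avoids \<open>b 2\<close>.\<close>
    proof (cases "b 2 \<in> C - {s, t}")
      case True
      have "b 1 \<noteq> b 2" using b[of 1] 2 by (simp add: numeral_2_eq_2)
      then show ?thesis
        using 2 z True by (intro exI[of _ "\<lambda>i. if i = 0 then b 2 else z"]) (auto simp: numeral_2_eq_2)
    next
      case False
      obtain u where u: "u \<in> C" "u \<noteq> s" "u \<noteq> t" "u \<noteq> b 0"
        using ex_color3[OF C] by metis
      obtain v where v: "v \<in> C" "v \<noteq> s" "v \<noteq> t" "v \<noteq> u"
        using ex_color3[OF C] by metis
      show ?thesis
        using 2 u v False by (intro exI[of _ "\<lambda>i. if i = 0 then v else u"]) (auto simp: numeral_2_eq_2)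
    qed
  next
    case 3
    obtain u where u: "u \<in> C" "u \<noteq> s" "u \<noteq> t"
      using ex_color3[OF C] by metis
    then obtain y where y: "y 0 = u" "y n = z" "range y \<subseteq> C"
        "\<forall>i<n. y i \<noteq> y (Suc i) \<and> \<not> (y i = b (Suc i) \<and> y (Suc i) = b i)"
      using path_fill[OF C 3 u(1) z(1), of b] by blast
    have "y 0 \<notin> {s, t}" "y n \<notin> {s, t, b (Suc n)}"
      using y(1,2) u z by simp_all
    with y(3,4) show ?thesis by blast
  qed
qed

definition cycle_proper :: "nat \<Rightarrow> (nat \<Rightarrow> nat) \<Rightarrow> bool" where
  "cycle_proper k f \<longleftrightarrow> (\<forall>i<k. f i \<noteq> f (Suc i)) \<and> f k \<noteq> f 0"

text \<open>
  Both neighbors of the root get the first color \<open>e\<close>, which differs from the root's first three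
  colors, so the root is never passed through. The second colors are chosen before the first ones;
  they agree at the two neighbors of vertex \<open>m + 2\<close>, which leaves enough freedom to close the
  cycle there. Requiring \<open>x (Suc i) \<noteq> y i\<close> rules out swaps in the middle step.
\<close>

lemma cycle_coloring_long:
  fixes a b :: "nat \<Rightarrow> nat"
  assumes C: "4 \<le> card C" and k: "k = m + 3" and "cycle_proper k a" "cycle_proper k b"
    and c: "c1 \<in> C" "c2 \<in> C"
  shows "\<exists>x y. x 0 = c1 \<and> y 0 = c2 \<and> range x \<subseteq> C \<and> range y \<subseteq> C \<and>
    cycle_proper k x \<and> cycle_proper k y \<and>
    cycle_one_shot k a x \<and> cycle_one_shot k x y \<and> cycle_one_shot k y b"
proof -
  have ab: "a i \<noteq> a (Suc i)" "b i \<noteq> b (Suc i)" if "i < m + 3" for i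
    using assms(3,4) that by (auto simp: cycle_proper_def k)
  obtain e where e: "e \<in> C" "e \<noteq> a 0" "e \<noteq> c1" "e \<noteq> c2"
    using ex_color3[OF C] by metis
  \<comment> \<open>Indices are shifted by one: \<open>y' i\<close>, and later \<open>x' i\<close>,
    belong to vertex \<open>i + 1\<close>.\<close>
  obtain y' where y': "y' 0 \<notin> {c2, b 0}" "y' m \<notin> {c2, b 0, b (m + 2)}" "range y' \<subseteq> C"
      "\<And>i. i < m \<Longrightarrow> y' i \<noteq> y' (Suc i)"
      "\<And>i. i < m \<Longrightarrow> \<not> (y' i = b (Suc (Suc i)) \<and> y' (Suc i) = b (Suc i))"
    using path_coloring[OF C, of m "\<lambda>i. b (Suc i)" c2 "b 0"] ab by auto
  \<comment> \<open>Each first color avoids three others: the preceding first color, and the second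
    and the original color of the preceding vertex, so that neither of the first two steps swaps
    along this edge.\<close>
  have "\<exists>x'. \<forall>i. (x' i \<in> C \<and> (i = 0 \<longrightarrow> x' i = e)) \<and>
      (x' (Suc i) \<noteq> x' i \<and> x' (Suc i) \<noteq> y' i \<and> x' (Suc i) \<noteq> a (Suc i))"
  proof (rule dependent_nat_choice)
    show "\<exists>z. z \<in> C \<and> (0 = (0 :: nat) \<longrightarrow> z = e)" using e(1) by blast
  next
    fix z i
    show "\<exists>w. (w \<in> C \<and> (Suc i = 0 \<longrightarrow> w = e)) \<and> w \<noteq> z \<and> w \<noteq> y' i \<and> w \<noteq> a (Suc i)"
      using ex_color3[OF C, of z "y' i" "a (Suc i)"] by blast
  qed
  then obtain x' where "\<forall>i. (x' i \<in> C \<and> (i = 0 \<longrightarrow> x' i = e)) \<and>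
      (x' (Suc i) \<noteq> x' i \<and> x' (Suc i) \<noteq> y' i \<and> x' (Suc i) \<noteq> a (Suc i))" ..
  then have x': "x' i \<in> C" "x' 0 = e"
      "x' (Suc i) \<noteq> x' i" "x' (Suc i) \<noteq> y' i" "x' (Suc i) \<noteq> a (Suc i)" for i
    by auto
  \<comment> \<open>The cycle closes at vertex \<open>m + 2\<close>. Its first color
    \<open>u\<close> fits between \<open>x' m\<close> and \<open>e\<close>; its second color
    \<open>v\<close> avoids the first colors of both neighbors, so no swap occurs there in the
    middle step.\<close>
  obtain u where u: "u \<in> C" "u \<noteq> x' m" "u \<noteq> e"
      "\<not> (x' m = a (m + 2) \<and> u = a (m + 1))" "\<not> (u = a (m + 3) \<and> e = a (m + 2))"
    using ex_color_between[OF C] by metis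
  obtain v where v: "v \<in> C" "v \<noteq> y' m" "v \<noteq> x' m" "v \<noteq> e"
    using ex_color3[OF C] by metis
  define x where "x i = (if i = 0 then c1 else if i \<le> m + 1 then x' (i - 1)
      else if i = m + 2 then u else e)" for i
  define y where "y i = (if i = 0 then c2 else if i \<le> m + 1 then y' (i - 1)
      else if i = m + 2 then v else y' m)" for i
  have split: "P i" if "i < m + 3" "P 0" "P (m + 1)" "P (m + 2)" "\<And>j. j < m \<Longrightarrow> P (Suc j)"
    for i and P :: "nat \<Rightarrow> bool"
  proof -
    consider "i = 0" | "i = m + 1" | "i = m + 2" | j where "i = Suc j" "j < m"
      using \<open>i < m + 3\<close> by (cases i) force+
    then show ?thesis using that(2-) by cases auto
  qed
  have x_simps: "x 0 = c1" "x 1 = e" "x (m + 1) = x' m" "x (m + 2) = u" "x (m + 3) = e"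
      "\<And>j. j < m \<Longrightarrow> x (Suc j) = x' j" "\<And>j. j < m \<Longrightarrow> x (Suc (Suc j)) = x' (Suc j)"
    and y_simps: "y 0 = c2" "y 1 = y' 0" "y (m + 1) = y' m" "y (m + 2) = v" "y (m + 3) = y' m"
      "\<And>j. j < m \<Longrightarrow> y (Suc j) = y' j" "\<And>j. j < m \<Longrightarrow> y (Suc (Suc j)) = y' (Suc j)"
    by (auto simp: x_def y_def x'(2))
  have Suc: "Suc 0 = 1" "Suc (m + 1) = m + 2" "Suc (m + 2) = m + 3" by auto
  have x_proper: "x i \<noteq> x (Suc i)" if "i < m + 3" for i
    using that by (rule split) (simp_all only: Suc x_simps, use e x'(3)[THEN not_sym] u in auto)
  have y_proper: "y i \<noteq> y (Suc i)" if "i < m + 3" for i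
    using that by (rule split) (simp_all only: Suc y_simps, use y' v in auto)
  have ax: "\<not> (a i = x (Suc i) \<and> a (Suc i) = x i)" if "i < m + 3" for i
    using that by (rule split) (simp_all only: Suc x_simps, use e x'(5)[THEN not_sym] u in auto)
  have xy: "\<not> (x i = y (Suc i) \<and> x (Suc i) = y i)" if "i < m + 3" for i
    using that by (rule split) (simp_all only: Suc x_simps y_simps, use e x'(4) v in auto)
  have yb: "\<not> (y i = b (Suc i) \<and> y (Suc i) = b i)" if "i < m + 3" for i
    using that by (rule split) (simp_all only: Suc y_simps, use y' in auto)
  have "cycle_proper k x" "cycle_proper k y"
    using x_proper y_proper e y'(2) unfolding cycle_proper_def by (simp_all add: k x_simps y_simps)
  \<comment> \<open>No dependency runs through the root: in the first step no neighbor takes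
    \<open>a 0\<close>, in the second no neighbor holds \<open>c2\<close>, and in the third no
    neighbor holds \<open>b 0\<close>.\<close>
  moreover have "cycle_one_shot k a x" "cycle_one_shot k x y" "cycle_one_shot k y b"
    using ax xy yb e y'(1,2)
    by (auto intro!: cycle_one_shotI simp: k x_simps y_simps simp del: One_nat_def)
  moreover have "range x \<subseteq> C" "range y \<subseteq> C"
    using c e(1) x'(1) y'(3) u(1) v(1) by (auto simp: x_def y_def)
  ultimately show ?thesis
    using x_simps(1) y_simps(1) by blast
qed

text \<open>
  In a triangle the root may have to be passed through, so all cyclic dependencies have to be
  excluded explicitly.
\<close>

definition acyclic3 :: "nat \<Rightarrow> nat \<Rightarrow> nat \<Rightarrow> nat \<Rightarrow> nat \<Rightarrow> nat \<Rightarrow> bool" where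
  "acyclic3 p0 p1 p2 q0 q1 q2 \<longleftrightarrow>
     \<not> (p0 = q1 \<and> p1 = q0) \<and> \<not> (p1 = q2 \<and> p2 = q1) \<and> \<not> (p2 = q0 \<and> p0 = q2) \<and>
     \<not> (p0 = q1 \<and> p1 = q2 \<and> p2 = q0) \<and> \<not> (p1 = q0 \<and> p2 = q1 \<and> p0 = q2)"

text \<open>Reversing a step reverses all dependencies. The last step can thus be constructed
  backwards from the target, like the first one from the start.\<close>

lemma acyclic3_reverse: "acyclic3 p0 p1 p2 q0 q1 q2 \<longleftrightarrow> acyclic3 q0 q1 q2 p0 p1 p2"
  unfolding acyclic3_def by blast

text \<open>The first of the three positions is the root, whose new color \<open>c\<close> is
  prescribed; only the colors \<open>x1\<close> and \<open>x2\<close> of the other two may be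
  chosen.\<close>

definition triangle_step :: "nat set \<Rightarrow> nat \<Rightarrow> nat \<Rightarrow> nat \<Rightarrow> nat \<Rightarrow> nat \<Rightarrow> nat \<Rightarrow> bool" where
  "triangle_step C c0 a1 a2 c x1 x2 \<longleftrightarrow>
     x1 \<in> C \<and> x2 \<in> C \<and> c \<noteq> x1 \<and> c \<noteq> x2 \<and> x1 \<noteq> x2 \<and> acyclic3 c0 a1 a2 c x1 x2"

lemma ex_ne_of_two:
  assumes "P x1 x2" "P y1 y2" "x1 \<noteq> y1 \<or> x2 \<noteq> y2"
  shows "\<exists>u v. P u v \<and> \<not> (u = s \<and> v = t)"
  using assms by blast

locale triangle_coloring =
  fixes C :: "nat set" and c0 a1 a2 :: nat
  assumes C: "4 \<le> card C" and in_C: "c0 \<in> C" "a1 \<in> C" "a2 \<in> C"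
    and distinct: "c0 \<noteq> a1" "c0 \<noteq> a2" "a1 \<noteq> a2"
begin

text \<open>Neither neighbor holds the color \<open>c\<close> claimed by the root. When at most one
  neighbor is recolored, the only possible dependency is that it waits for the root's old
  color.\<close>

lemma stepI:
  assumes "c \<noteq> a1" "c \<noteq> a2"
  shows "triangle_step C c0 a1 a2 c a1 a2"
    and "z \<in> C \<Longrightarrow> z \<noteq> c \<Longrightarrow> z \<noteq> a2 \<Longrightarrow> triangle_step C c0 a1 a2 c z a2"
    and "z \<in> C \<Longrightarrow> z \<noteq> c \<Longrightarrow> z \<noteq> a1 \<Longrightarrow> triangle_step C c0 a1 a2 c a1 z"
  using assms in_C distinct unfolding triangle_step_def acyclic3_def by auto

text \<open>The root claims the color of vertex 1. The dependencies form a chain that starts with a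
  vertex moving to the fresh color \<open>z\<close>, hence never close up.\<close>

lemma stepI1:
  assumes "z \<in> C" "z \<noteq> c0" "z \<noteq> a1" "z \<noteq> a2"
  shows "triangle_step C c0 a1 a2 a1 z a2" "triangle_step C c0 a1 a2 a1 a2 z"
    "triangle_step C c0 a1 a2 a1 z c0"
  using assms in_C distinct unfolding triangle_step_def acyclic3_def by auto

lemma stepI2:
  assumes "z \<in> C" "z \<noteq> c0" "z \<noteq> a1" "z \<noteq> a2"
  shows "triangle_step C c0 a1 a2 a2 a1 z" "triangle_step C c0 a1 a2 a2 z a1"
    "triangle_step C c0 a1 a2 a2 c0 z"
  using assms in_C distinct unfolding triangle_step_def acyclic3_def by auto

text \<open>Two different admissible steps exist, so one misses the forbidden pair. That pair will
  be the one that swaps the two other vertices in the middle step.\<close>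

lemma ex_step_ne: "\<exists>x1 x2. triangle_step C c0 a1 a2 c x1 x2 \<and> \<not> (x1 = s \<and> x2 = t)"
proof -
  obtain z where z: "z \<in> C" "z \<noteq> c0" "z \<noteq> a1" "z \<noteq> a2"
    using ex_color3[OF C] by metis
  obtain w where w: "w \<in> C" "w \<noteq> c" "w \<noteq> a1" "w \<noteq> a2"
    using ex_color3[OF C] by metis
  consider "c = a1" | "c = a2" | "c \<noteq> a1" "c \<noteq> a2" by blast
  then show ?thesis
  proof cases
    case 1
    then show ?thesis using ex_ne_of_two[where P = "triangle_step C c0 a1 a2 a1", OF stepI1(1,2)[OF z]] z by blast
  next
    case 2
    then show ?thesis using ex_ne_of_two[where P = "triangle_step C c0 a1 a2 a2", OF stepI2(1,2)[OF z]] z by blast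
  next
    case 3
    then show ?thesis using ex_ne_of_two[where P = "triangle_step C c0 a1 a2 c", OF stepI(1)[OF 3] stepI(2)[OF 3 w(1,2,4)]] w(3) by blast
  qed
qed

text \<open>\<open>d\<close> is the root's color on the other side of the middle step. If neither
  neighbor uses it, that step can fail only by a swap of the two other vertices. In the excluded
  case freeing \<open>c\<close> requires a fresh color, and \<open>d\<close> may be the only
  one.\<close>

lemma ex_step_avoiding:
  assumes "\<not> (c \<in> {a1, a2} \<and> d \<notin> {c0, a1, a2})"
  shows "\<exists>x1 x2. triangle_step C c0 a1 a2 c x1 x2 \<and> d \<noteq> x1 \<and> d \<noteq> x2"
proof -
  obtain z where z: "z \<in> C" "z \<noteq> c0" "z \<noteq> a1" "z \<noteq> a2"
    using ex_color3[OF C] by metis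
  obtain w where w: "w \<in> C" "w \<noteq> c" "w \<noteq> a1" "w \<noteq> a2"
    using ex_color3[OF C] by metis
  consider "c = a1" | "c = a2" | "c \<noteq> a1" "c \<noteq> a2" by blast
  then show ?thesis
  proof cases
    case 1
    then have "d \<noteq> z" using assms z by auto
    then show ?thesis using 1 stepI1(1,3)[OF z] distinct by (cases "d = a2") blast+
  next
    case 2
    then have "d \<noteq> z" using assms z by auto
    then show ?thesis using 2 stepI2(2,3)[OF z] distinct by (cases "d = a1") blast+
  next
    case 3
    consider "d = a1" | "d = a2" | "d \<noteq> a1" "d \<noteq> a2" by blast
    then show ?thesis
    proof cases
      case 1
      then show ?thesis using stepI(2)[OF 3 w(1,2,4)] w(3) distinct by blast
    next
      case 2
      then show ?thesis using stepI(3)[OF 3 w(1-3)] w(4) distinct by blast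
    next
      case 3
      then show ?thesis using stepI(1)[OF \<open>c \<noteq> a1\<close> \<open>c \<noteq> a2\<close>] by blast
    qed
  qed
qed

end

lemma triangle_coloring_ex:
  assumes A: "triangle_coloring C c0 a1 a2" and B: "triangle_coloring C c3 b1 b2"
    and c: "c1 \<in> C" "c2 \<in> C"
  shows "\<exists>x1 x2 y1 y2. triangle_step C c0 a1 a2 c1 x1 x2 \<and> triangle_step C c3 b1 b2 c2 y1 y2 \<and>
    acyclic3 c1 x1 x2 c2 y1 y2"
proof -
  interpret A: triangle_coloring C c0 a1 a2 by fact
  interpret B: triangle_coloring C c3 b1 b2 by fact
  consider (A) "\<not> (c1 \<in> {a1, a2} \<and> c2 \<notin> {c0, a1, a2})"
    | (B) "\<not> (c2 \<in> {b1, b2} \<and> c1 \<notin> {c3, b1, b2})"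
    | (C) "c1 \<in> {a1, a2}" "c2 \<notin> {c0, a1, a2}" "c2 \<in> {b1, b2}" "c1 \<notin> {c3, b1, b2}"
    by blast
  then show ?thesis
  proof cases
    case A
    obtain x1 x2 where x: "triangle_step C c0 a1 a2 c1 x1 x2" "c2 \<noteq> x1" "c2 \<noteq> x2"
      using A.ex_step_avoiding[OF A] by blast
    obtain y1 y2 where y: "triangle_step C c3 b1 b2 c2 y1 y2" "\<not> (y1 = x2 \<and> y2 = x1)"
      using B.ex_step_ne by blast
    have "acyclic3 c1 x1 x2 c2 y1 y2" using x y by (auto simp: acyclic3_def)
    with x y show ?thesis by blast
  next
    case B
    obtain y1 y2 where y: "triangle_step C c3 b1 b2 c2 y1 y2" "c1 \<noteq> y1" "c1 \<noteq> y2"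
      using B.ex_step_avoiding[OF B] by blast
    obtain x1 x2 where x: "triangle_step C c0 a1 a2 c1 x1 x2" "\<not> (x1 = y2 \<and> x2 = y1)"
      using A.ex_step_ne by blast
    have "acyclic3 c1 x1 x2 c2 y1 y2" using x y by (auto simp: acyclic3_def)
    with x y show ?thesis by blast
  next
    \<comment> \<open>Both sides are obstructed. One neighbor takes \<open>c2\<close> first and
      hands it to the root, the other then takes \<open>c1\<close> from the root. This chain closes
      only if the first neighbor continues with the other one's first color, which \<open>z\<close>
      avoids.\<close>
    case C
    have c2: "c2 \<noteq> c0" "c2 \<noteq> a1" "c2 \<noteq> a2" and c1: "c1 \<noteq> c3" "c1 \<noteq> b1" "c1 \<noteq> b2"
      using C by auto
    consider "c1 = a1" "c2 = b1" | "c1 = a1" "c2 = b2" | "c1 = a2" "c2 = b1" | "c1 = a2" "c2 = b2"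
      using C by blast
    then show ?thesis
    proof cases
      case 1
      obtain z where z: "triangle_step C c3 b1 b2 c2 c1 z" "z \<noteq> a2" "z \<noteq> c1"
        proof (cases "b2 = a2")
        case True
        then show ?thesis using that[of c3] B.stepI1(3)[OF c(1) c1] B.distinct c1 1 by simp
      next
        case False
        then show ?thesis using that[of b2] B.stepI1(1)[OF c(1) c1] B.distinct c1 1 by simp
      qed
      have "acyclic3 c1 a2 c2 c2 c1 z"
        using z c2 1 A.distinct by (auto simp: acyclic3_def)
      then show ?thesis using A.stepI1(2)[OF c(2) c2] z 1 by blast
    next
      case 2
      obtain z where z: "triangle_step C c3 b1 b2 c2 z c1" "z \<noteq> a2" "z \<noteq> c1"
        proof (cases "b1 = a2")
        case True
        then show ?thesis using that[of c3] B.stepI2(3)[OF c(1) c1] B.distinct c1 2 by simp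
      next
        case False
        then show ?thesis using that[of b1] B.stepI2(1)[OF c(1) c1] B.distinct c1 2 by simp
      qed
      have "acyclic3 c1 c2 a2 c2 z c1"
        using z c2 2 A.distinct by (auto simp: acyclic3_def)
      then show ?thesis using A.stepI1(1)[OF c(2) c2] z 2 by blast
    next
      case 3
      obtain z where z: "triangle_step C c3 b1 b2 c2 c1 z" "z \<noteq> a1" "z \<noteq> c1"
        proof (cases "b2 = a1")
        case True
        then show ?thesis using that[of c3] B.stepI1(3)[OF c(1) c1] B.distinct c1 3 by simp
      next
        case False
        then show ?thesis using that[of b2] B.stepI1(1)[OF c(1) c1] B.distinct c1 3 by simp
      qed
      have "acyclic3 c1 a1 c2 c2 c1 z"
        using z c2 3 A.distinct by (auto simp: acyclic3_def)
      then show ?thesis using A.stepI2(1)[OF c(2) c2] z 3 by blast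
    next
      case 4
      obtain z where z: "triangle_step C c3 b1 b2 c2 z c1" "z \<noteq> a1" "z \<noteq> c1"
        proof (cases "b1 = a1")
        case True
        then show ?thesis using that[of c3] B.stepI2(3)[OF c(1) c1] B.distinct c1 4 by simp
      next
        case False
        then show ?thesis using that[of b1] B.stepI2(1)[OF c(1) c1] B.distinct c1 4 by simp
      qed
      have "acyclic3 c1 c2 a1 c2 z c1"
        using z c2 4 A.distinct by (auto simp: acyclic3_def)
      then show ?thesis using A.stepI2(2)[OF c(2) c2] z 4 by blast
    qed
  qed
qed

lemma cycle_coloring_triangle:
  fixes a b :: "nat \<Rightarrow> nat"
  assumes C: "4 \<le> card C" and "cycle_proper 2 a" "cycle_proper 2 b"
    and ab: "a ` {..2} \<subseteq> C" "b ` {..2} \<subseteq> C"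
    and c: "c1 \<in> C" "c2 \<in> C"
  shows "\<exists>x y. x 0 = c1 \<and> y 0 = c2 \<and> range x \<subseteq> C \<and> range y \<subseteq> C \<and>
    cycle_proper 2 x \<and> cycle_proper 2 y \<and>
    cycle_one_shot 2 a x \<and> cycle_one_shot 2 x y \<and> cycle_one_shot 2 y b"
proof -
  have proper: "cycle_proper 2 f \<longleftrightarrow> f 0 \<noteq> f 1 \<and> f 0 \<noteq> f 2 \<and> f 1 \<noteq> f 2" for f
    by (auto simp: cycle_proper_def less_Suc_eq numeral_2_eq_2)
  have in_C: "a 0 \<in> C" "a 1 \<in> C" "a 2 \<in> C" "b 0 \<in> C" "b 1 \<in> C" "b 2 \<in> C"
    using ab by (auto simp: image_subset_iff)
  have "triangle_coloring C (a 0) (a 1) (a 2)" "triangle_coloring C (b 0) (b 1) (b 2)"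
    using assms(2,3) in_C C by (auto simp: triangle_coloring_def proper)
  then obtain x1 x2 y1 y2 where xy: "triangle_step C (a 0) (a 1) (a 2) c1 x1 x2"
      "triangle_step C (b 0) (b 1) (b 2) c2 y1 y2" "acyclic3 c1 x1 x2 c2 y1 y2"
    using triangle_coloring_ex c by blast
  define x y where "x i = (if i = 0 then c1 else if i = 1 then x1 else x2)"
    and "y i = (if i = 0 then c2 else if i = 1 then y1 else y2)" for i :: nat
  have xy_simps: "x 0 = c1" "x 1 = x1" "x 2 = x2" "y 0 = c2" "y 1 = y1" "y 2 = y2"
    by (simp_all add: x_def y_def)
  have one_shot: "cycle_one_shot 2 p q" if "acyclic3 (p 0) (p 1) (p 2) (q 0) (q 1) (q 2)" for p q
    using that unfolding acyclic3_def by (elim conjE) (rule triangle_one_shotI)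
  have "cycle_one_shot 2 a x"
    using xy(1) by (intro one_shot) (simp only: triangle_step_def xy_simps)
  moreover have "cycle_one_shot 2 x y"
    using xy(3) by (intro one_shot) (simp only: xy_simps)
  moreover have "cycle_one_shot 2 y b"
    using xy(2) by (intro one_shot, subst acyclic3_reverse) (simp only: triangle_step_def xy_simps)
  moreover have "cycle_proper 2 x" "cycle_proper 2 y"
    using xy(1,2) by (simp_all only: triangle_step_def proper xy_simps) auto
  moreover have "range x \<subseteq> C" "range y \<subseteq> C"
    using xy(1,2) c by (auto simp: triangle_step_def x_def y_def)
  ultimately show ?thesis using xy_simps(1,4) by blast
qed

text \<open>Triangles are separate because the general construction gives both neighbors of vertex 0
  the same first color, and in a triangle they are adjacent.\<close>

theorem cycle_coloring:
  fixes a b :: "nat \<Rightarrow> nat"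
  assumes "4 \<le> card C" "2 \<le> k" "cycle_proper k a" "cycle_proper k b"
    and "a ` {..k} \<subseteq> C" "b ` {..k} \<subseteq> C" "c1 \<in> C" "c2 \<in> C"
  shows "\<exists>x y. x 0 = c1 \<and> y 0 = c2 \<and> range x \<subseteq> C \<and> range y \<subseteq> C \<and>
    cycle_proper k x \<and> cycle_proper k y \<and>
    cycle_one_shot k a x \<and> cycle_one_shot k x y \<and> cycle_one_shot k y b"
proof (cases "k = 2")
  case True
  show ?thesis using assms unfolding True by (intro cycle_coloring_triangle)
next
  case False
  then obtain m where "k = m + 3"
    using \<open>2 \<le> k\<close> by (metis add.commute le_add_diff_inverse le_neq_implies_less less_eq_Suc_le eval_nat_numeral(3))
  then show ?thesis using assms by (intro cycle_coloring_long)
qed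

section \<open>Nonseparable vertex sets\<close>

definition adj_in :: "('a \<Rightarrow> 'a \<Rightarrow> bool) \<Rightarrow> 'a set \<Rightarrow> 'a \<Rightarrow> 'a \<Rightarrow> bool" where
  "adj_in E W x y \<longleftrightarrow> E x y \<and> x \<in> W \<and> y \<in> W"

definition conn :: "('a \<Rightarrow> 'a \<Rightarrow> bool) \<Rightarrow> 'a set \<Rightarrow> bool" where
  "conn E W \<longleftrightarrow> (\<forall>x\<in>W. \<forall>y\<in>W. (adj_in E W)\<^sup>*\<^sup>* x y)"

text \<open>Connectedness without cut vertices, stated for vertex sets. The empty set counts as
  connected, so single vertices and pairs of ends of an edge are covered.\<close>

definition nonsep :: "('a \<Rightarrow> 'a \<Rightarrow> bool) \<Rightarrow> 'a set \<Rightarrow> bool" where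
  "nonsep E W \<longleftrightarrow> conn E W \<and> (\<forall>v. conn E (W - {v}))"

lemma adj_in_mono: "(adj_in E W)\<^sup>*\<^sup>* x y \<Longrightarrow> W \<subseteq> W' \<Longrightarrow> (adj_in E W')\<^sup>*\<^sup>* x y"
  by (erule rtranclp_mono[THEN predicate2D, rotated]) (auto simp: adj_in_def)

lemma adj_in_sym: "symp E \<Longrightarrow> (adj_in E W)\<^sup>*\<^sup>* x y \<Longrightarrow> (adj_in E W)\<^sup>*\<^sup>* y x"
  by (rule sympD[OF symp_rtranclp]) (auto simp: adj_in_def symp_def)

lemma reach_last:
  assumes "successively E (z # q)" "set (z # q) \<subseteq> W"
  shows "(adj_in E W)\<^sup>*\<^sup>* z (last (z # q))"
  using assms
proof (induction q arbitrary: z)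
  case (Cons a q)
  have "adj_in E W z a" using Cons.prems by (simp add: adj_in_def)
  moreover have "(adj_in E W)\<^sup>*\<^sup>* a (last (a # q))" using Cons.prems by (intro Cons.IH) auto
  ultimately show ?case by (simp add: converse_rtranclp_into_rtranclp)
qed simp

lemma reach_path:
  assumes "(adj_in E W)\<^sup>*\<^sup>* a b" "b \<in> W"
  obtains p where "distinct p" "p \<noteq> []" "hd p = a" "last p = b" "successively E p" "set p \<subseteq> W"
proof -
  have "\<exists>p. distinct p \<and> p \<noteq> [] \<and> hd p = a \<and> last p = b \<and> successively E p \<and> set p \<subseteq> W"
    using assms(1)
  proof (induction rule: converse_rtranclp_induct)
    case base
    then show ?case using assms(2) by (intro exI[of _ "[b]"]) simp
  next
    case (step a a')
    then obtain p where p: "distinct p" "p \<noteq> []" "hd p = a'" "last p = b" "successively E p" "set p \<subseteq> W"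
      by blast
    show ?case
    proof (cases "a \<in> set p")
      case True
      then obtain p1 p2 where "p = p1 @ a # p2" by (auto simp: in_set_conv_decomp)
      with p show ?thesis
        by (intro exI[of _ "a # p2"]) (auto simp: successively_append_iff)
    next
      case False
      with p step(1) show ?thesis
        by (intro exI[of _ "a # p"]) (auto simp: adj_in_def successively_Cons)
    qed
  qed
  then show thesis using that by blast
qed

lemma conn_hub:
  assumes "symp E" "conn E X" "X \<subseteq> Y"
    and "\<And>z. z \<in> Y - X \<Longrightarrow> \<exists>x\<in>X. (adj_in E Y)\<^sup>*\<^sup>* z x"
  shows "conn E Y"
proof -
  have hub: "\<exists>x\<in>X. (adj_in E Y)\<^sup>*\<^sup>* z x" if "z \<in> Y" for z
    using that assms(4)[of z] by (cases "z \<in> X") auto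
  show ?thesis
    unfolding conn_def
  proof (intro ballI)
    fix z z' assume "z \<in> Y" "z' \<in> Y"
    then obtain x x' where x: "x \<in> X" "(adj_in E Y)\<^sup>*\<^sup>* z x" "x' \<in> X" "(adj_in E Y)\<^sup>*\<^sup>* z' x'"
      using hub by metis
    moreover have "(adj_in E Y)\<^sup>*\<^sup>* x x'"
      using assms(2,3) x(1,3) adj_in_mono unfolding conn_def by metis
    ultimately show "(adj_in E Y)\<^sup>*\<^sup>* z z'"
      using adj_in_sym[OF assms(1) x(4)] by (meson rtranclp_trans)
  qed
qed

text \<open>After deletion of any vertex, every remaining vertex of the ear still reaches the old
  set along the side of the ear that avoids the deleted vertex.\<close>

lemma nonsep_ear:
  assumes sym: "symp E" and X: "nonsep E X" and xy: "x \<in> X" "y \<in> X" "x \<noteq> y"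
    and W: "W \<inter> X = {}" and ab: "E x a" "(adj_in E W)\<^sup>*\<^sup>* a b" "E b y" "b \<in> W"
  shows "\<exists>Y. nonsep E Y \<and> X \<subset> Y \<and> Y \<subseteq> X \<union> W"
proof -
  obtain p where p: "distinct p" "p \<noteq> []" "hd p = a" "last p = b" "successively E p" "set p \<subseteq> W"
    using reach_path ab(2,4) .
  have path: "successively E (x # p @ [y])"
    using p ab(1,3) by (simp add: successively_Cons successively_append_iff)
  have conn: "conn E (X \<union> set p - {v})" for v
  proof (rule conn_hub[OF sym, of "X - {v}"])
    show "conn E (X - {v})" using X by (simp add: nonsep_def)
    fix z assume z: "z \<in> X \<union> set p - {v} - (X - {v})"
    then obtain p1 p2 where split: "p = p1 @ z # p2" by (auto simp: in_set_conv_decomp)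
    have "z \<noteq> v" using z by auto
    show "\<exists>x\<in>X - {v}. (adj_in E (X \<union> set p - {v}))\<^sup>*\<^sup>* z x"
    proof (cases "v \<in> insert x (set p1)")
      case True
      then have v: "v \<notin> insert y (set p2)"
        using p(1,6) W xy unfolding split by auto
      have "(adj_in E (X \<union> set p - {v}))\<^sup>*\<^sup>* z (last (z # p2 @ [y]))"
        using path v xy \<open>z \<noteq> v\<close> unfolding split
        by (intro reach_last) (auto simp: successively_append_iff successively_Cons)
      then show ?thesis using v xy by auto
    next
      case False
      have "successively E ((x # p1 @ [z]) @ (p2 @ [y]))"
        using path unfolding split by simp
      then have "successively E (x # p1 @ [z])"
        unfolding successively_append_iff by blast
      moreover have "(\<lambda>x y. E y x) = E"
        using sym by (auto simp: symp_def)
      ultimately have "successively E (rev (x # p1 @ [z]))"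
        by (simp only: successively_rev)
      then have "(adj_in E (X \<union> set p - {v}))\<^sup>*\<^sup>* z (last (z # rev p1 @ [x]))"
        using False xy \<open>z \<noteq> v\<close> unfolding split by (intro reach_last) auto
      then show ?thesis using False xy by auto
    qed
  qed auto
  have "conn E (X \<union> set p)"
  \<comment> \<open>Deleting a vertex outside changes nothing. If the set exhausts the type,
    deleting \<open>y\<close> still leaves every ear vertex connected to \<open>x\<close>.\<close>
  proof (cases "\<exists>v. v \<notin> X \<union> set p")
    case True
    then show ?thesis using conn by (metis Diff_empty Diff_insert0)
  next
    case False
    show ?thesis
    proof (rule conn_hub[OF sym, of X])
      show "conn E X" using X by (simp add: nonsep_def)
      fix z assume z: "z \<in> X \<union> set p - X"
      then have "z \<noteq> y" "x \<noteq> y" using xy by auto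
      then have "(adj_in E (X \<union> set p - {y}))\<^sup>*\<^sup>* z x"
        using conn[of y] z xy by (auto simp: conn_def)
      then show "\<exists>x\<in>X. (adj_in E (X \<union> set p))\<^sup>*\<^sup>* z x"
        using xy adj_in_mono by (metis Diff_subset)
    qed auto
  qed
  moreover have "X \<subset> X \<union> set p"
    using p(2,6) W by (cases p) auto
  ultimately show ?thesis
    using conn p(6) by (intro exI[of _ "X \<union> set p"]) (auto simp: nonsep_def)
qed

section \<open>Extending schedules block by block\<close>

definition one_shot :: "('a \<Rightarrow> 'a \<Rightarrow> bool) \<Rightarrow> 'a set \<Rightarrow> ('a \<Rightarrow> nat) \<Rightarrow> ('a \<Rightarrow> nat) \<Rightarrow> bool" where
  "one_shot E W f f' \<longleftrightarrow>
     (\<exists>\<rho> :: 'a \<Rightarrow> int. \<forall>x\<in>W. \<forall>y\<in>W. E x y \<longrightarrow> f x = f' y \<longrightarrow> \<rho> x < \<rho> y)"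

definition proper_on :: "('a \<Rightarrow> 'a \<Rightarrow> bool) \<Rightarrow> nat set \<Rightarrow> 'a set \<Rightarrow> ('a \<Rightarrow> nat) \<Rightarrow> bool" where
  "proper_on E C W f \<longleftrightarrow> f ` W \<subseteq> C \<and> (\<forall>x\<in>W. \<forall>y\<in>W. E x y \<longrightarrow> f x \<noteq> f y)"

lemma one_shot_cong:
  "(\<And>x. x \<in> W \<Longrightarrow> f x = g x) \<Longrightarrow> (\<And>x. x \<in> W \<Longrightarrow> f' x = g' x) \<Longrightarrow>
    one_shot E W f f' \<longleftrightarrow> one_shot E W g g'"
  unfolding one_shot_def by simp

lemma proper_on_cong:
  "(\<And>x. x \<in> W \<Longrightarrow> f x = g x) \<Longrightarrow> proper_on E C W f \<longleftrightarrow> proper_on E C W g"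
  unfolding proper_on_def by (simp add: image_subset_iff)

definition edges_split :: "('a \<Rightarrow> 'a \<Rightarrow> bool) \<Rightarrow> 'a set \<Rightarrow> 'a set \<Rightarrow> bool" where
  "edges_split E S X \<longleftrightarrow> (\<forall>x \<in> S \<union> X. \<forall>y \<in> S \<union> X. E x y \<longrightarrow> {x, y} \<subseteq> S \<or> {x, y} \<subseteq> X)"

lemma proper_on_glue:
  "edges_split E S X \<Longrightarrow> proper_on E C S f \<Longrightarrow> proper_on E C X f \<Longrightarrow> proper_on E C (S \<union> X) f"
  unfolding edges_split_def proper_on_def by (simp add: image_Un) metis

text \<open>The two ranks agree on the common vertex after a shift, which is why ranks are integers.\<close>

lemma one_shot_glue:
  assumes split: "edges_split E S X" and u: "S \<inter> X = {u}"
    and "one_shot E S f f'" "one_shot E X f f'"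
  shows "one_shot E (S \<union> X) f f'"
proof -
  obtain \<rho> :: "'a \<Rightarrow> int" where \<rho>: "\<forall>x\<in>S. \<forall>y\<in>S. E x y \<longrightarrow> f x = f' y \<longrightarrow> \<rho> x < \<rho> y"
    using assms(3) unfolding one_shot_def by blast
  obtain \<sigma> :: "'a \<Rightarrow> int" where \<sigma>: "\<forall>x\<in>X. \<forall>y\<in>X. E x y \<longrightarrow> f x = f' y \<longrightarrow> \<sigma> x < \<sigma> y"
    using assms(4) unfolding one_shot_def by blast
  define \<tau> where "\<tau> x = (if x \<in> S then \<rho> x else \<sigma> x + (\<rho> u - \<sigma> u))" for x
  have \<tau>_S: "\<tau> x = \<rho> x" if "x \<in> S" for x
    using that by (simp add: \<tau>_def)
  have \<tau>_X: "\<tau> x = \<sigma> x + (\<rho> u - \<sigma> u)" if "x \<in> X" for x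
  proof (cases "x \<in> S")
    case True
    then have "x = u" using u that by blast
    then show ?thesis using True by (simp add: \<tau>_def)
  qed (simp add: \<tau>_def)
  have "\<tau> x < \<tau> y" if "x \<in> S \<union> X" "y \<in> S \<union> X" "E x y" "f x = f' y" for x y
  proof -
    have "{x, y} \<subseteq> S \<or> {x, y} \<subseteq> X" using split that unfolding edges_split_def by blast
    then show ?thesis using \<rho> \<sigma> that(3,4) by (auto simp: \<tau>_S \<tau>_X)
  qed
  then show ?thesis unfolding one_shot_def by blast
qed

locale reconf_instance =
  fixes V :: "'a set" and E :: "'a \<Rightarrow> 'a \<Rightarrow> bool" and C :: "nat set" and \<alpha> \<beta> :: "'a \<Rightarrow> nat"
  assumes finite: "finite V" and sym: "symp E" and irrefl: "\<not> E x x"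
    and C: "4 \<le> card C" and \<alpha>: "proper_on E C V \<alpha>" and \<beta>: "proper_on E C V \<beta>"
begin

definition schedule :: "'a set \<Rightarrow> ('a \<Rightarrow> nat) \<Rightarrow> ('a \<Rightarrow> nat) \<Rightarrow> bool" where
  "schedule W g h \<longleftrightarrow> proper_on E C W g \<and> proper_on E C W h \<and>
     one_shot E W \<alpha> g \<and> one_shot E W g h \<and> one_shot E W h \<beta>"

text \<open>The freedom at \<open>u\<close> lets a block agree there with whatever schedule has been
  fixed before.\<close>

definition extendable :: "'a set \<Rightarrow> 'a \<Rightarrow> bool" where
  "extendable X u \<longleftrightarrow> (\<forall>c1\<in>C. \<forall>c2\<in>C. \<exists>g h. schedule X g h \<and> g u = c1 \<and> h u = c2)"

lemma schedule_cong:
  "(\<And>x. x \<in> W \<Longrightarrow> g x = g' x) \<Longrightarrow> (\<And>x. x \<in> W \<Longrightarrow> h x = h' x) \<Longrightarrow>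
    schedule W g h \<longleftrightarrow> schedule W g' h'"
  unfolding schedule_def
  using proper_on_cong[of W g g'] proper_on_cong[of W h h'] one_shot_cong[of W \<alpha> \<alpha> g g']
    one_shot_cong[of W g g' h h'] one_shot_cong[of W h h' \<beta> \<beta>]
  by simp

lemma schedule_extend:
  assumes "schedule S g h" "extendable X u" "edges_split E S X" "S \<inter> X = {u}"
  shows "\<exists>g' h'. schedule (S \<union> X) g' h'"
proof -
  have u: "u \<in> S" "u \<in> X" using assms(4) by auto
  then have "g u \<in> C" "h u \<in> C"
    using assms(1) unfolding schedule_def proper_on_def by auto
  then obtain g1 h1 where 1: "schedule X g1 h1" "g1 u = g u" "h1 u = h u"
    using assms(2) unfolding extendable_def by blast
  define g' h' where "g' x = (if x \<in> S then g x else g1 x)"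
    and "h' x = (if x \<in> S then h x else h1 x)" for x
  have "g' x = g1 x \<and> h' x = h1 x" if "x \<in> X" for x
  proof (cases "x \<in> S")
    case True
    then have "x = u" using that assms(4) by blast
    then show ?thesis using 1 u by (simp add: g'_def h'_def)
  qed (simp add: g'_def h'_def)
  then have "schedule X g' h'" using 1(1) schedule_cong by blast
  moreover have "schedule S g' h'"
    using assms(1) schedule_cong[of S g g' h h'] by (simp add: g'_def h'_def)
  ultimately show ?thesis
    using proper_on_glue[OF assms(3)] one_shot_glue[OF assms(3,4)] unfolding schedule_def by blast
qed

text \<open>On an edge only a swap can go wrong. It is excluded in each step since \<open>d1\<close>
  differs from \<open>\<alpha> u\<close> and \<open>c2\<close>, and \<open>d2\<close> from
  \<open>\<beta> u\<close>.\<close>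

lemma extendable_edge:
  assumes "u \<in> V" "w \<in> V" "E u w"
  shows "extendable {u, w} u"
  unfolding extendable_def
proof (intro ballI)
  fix c1 c2 assume c: "c1 \<in> C" "c2 \<in> C"
  obtain d1 where d1: "d1 \<in> C" "d1 \<noteq> \<alpha> u" "d1 \<noteq> c1" "d1 \<noteq> c2" using ex_color3[OF C] by metis
  obtain d2 where d2: "d2 \<in> C" "d2 \<noteq> c2" "d2 \<noteq> \<beta> u" using ex_color3[OF C] by metis
  define g h where "g = (\<lambda>_. d1)(u := c1)" and "h = (\<lambda>_. d2)(u := c2)"
  have "u \<noteq> w" using assms(3) irrefl by blast
  have pair: "one_shot E {u, w} f f'" if "\<not> (f u = f' w \<and> f w = f' u)" for f f'
    unfolding one_shot_def
    using that \<open>u \<noteq> w\<close> irrefl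
    by (intro exI[of _ "\<lambda>x. if (x = u) = (f u = f' w) then 0 else 1"]) auto
  have "proper_on E C {u, w} g" "proper_on E C {u, w} h"
    using d1 d2 c \<open>u \<noteq> w\<close> irrefl by (auto simp: proper_on_def g_def h_def)
  moreover have "one_shot E {u, w} \<alpha> g" "one_shot E {u, w} g h" "one_shot E {u, w} h \<beta>"
    using d1 d2 \<open>u \<noteq> w\<close> by (intro pair; auto simp: g_def h_def)+
  ultimately show "\<exists>g h. schedule {u, w} g h \<and> g u = c1 \<and> h u = c2"
    unfolding schedule_def by (intro exI[of _ g] exI[of _ h]) (simp add: g_def h_def)
qed

text \<open>A periodic enumeration makes the successor uniform across the closing edge.
  Chordlessness turns every edge on the range into a cyclically consecutive pair, so
  \<open>cycle_coloring\<close> carries over.\<close>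

lemma extendable_cycle:
  fixes v :: "nat \<Rightarrow> 'a"
  assumes "2 \<le> k" and period: "\<And>i j. v i = v j \<longleftrightarrow> i mod Suc k = j mod Suc k"
    and "range v \<subseteq> V" and adj: "\<And>i. E (v i) (v (Suc i))"
    and chordless: "\<And>i j. E (v i) (v j) \<Longrightarrow> v j = v (Suc i) \<or> v i = v (Suc j)"
  shows "extendable (range v) (v 0)"
  unfolding extendable_def
proof (intro ballI)
  fix c1 c2 assume c: "c1 \<in> C" "c2 \<in> C"
  have wrap: "v (Suc k) = v 0" by (simp add: period)
  have cyc: "cycle_proper k (f \<circ> v)" if "proper_on E C V f" for f
  proof -
    have "f (v i) \<noteq> f (v (Suc i))" for i
      using that adj[of i] \<open>range v \<subseteq> V\<close> unfolding proper_on_def by blast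
    then show ?thesis using wrap unfolding cycle_proper_def by (metis comp_apply)
  qed
  have rng: "(f \<circ> v) ` {..k} \<subseteq> C" if "proper_on E C V f" for f
    using that \<open>range v \<subseteq> V\<close> unfolding proper_on_def by auto
  obtain x y where xy: "x 0 = c1" "y 0 = c2" "range x \<subseteq> C" "range y \<subseteq> C"
      "cycle_proper k x" "cycle_proper k y"
      "cycle_one_shot k (\<alpha> \<circ> v) x" "cycle_one_shot k x y" "cycle_one_shot k y (\<beta> \<circ> v)"
    using cycle_coloring[OF C \<open>2 \<le> k\<close> cyc[OF \<alpha>] cyc[OF \<beta>] rng[OF \<alpha>] rng[OF \<beta>] c] by blast
  \<comment> \<open>\<open>inv v\<close> chooses some position of \<open>z\<close>; reduction modulo
    \<open>Suc k\<close> makes it the canonical one between 0 and \<open>k\<close>.\<close>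
  define idx where "idx z = inv v z mod Suc k" for z
  have idx: "idx (v i) = i mod Suc k" for i
    using period[of "inv v (v i)" i] by (simp add: idx_def f_inv_into_f)
  have v_idx: "v (idx z) = z" if "z \<in> range v" for z
    using that by (auto simp: idx period)
  have idx_le: "idx z \<le> k" for z
    by (simp add: idx_def less_Suc_eq_le[symmetric])
  have idx_Suc: "idx w = (if idx z = k then 0 else Suc (idx z))" if "w = v (Suc i)" "z = v i" for w z i
    using that by (simp add: idx mod_Suc)
  have edge: "idx z < k \<and> idx w = Suc (idx z) \<or> idx w < k \<and> idx z = Suc (idx w) \<or>
      idx z = k \<and> idx w = 0 \<or> idx w = k \<and> idx z = 0"
    if zw: "z \<in> range v" "w \<in> range v" "E z w" for z w
  proof -
    obtain i j where ij: "z = v i" "w = v j" using zw(1,2) by auto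
    then consider "w = v (Suc i)" | "z = v (Suc j)" using chordless zw(3) by blast
    then show ?thesis
    proof cases
      case 1
      then have "idx w = (if idx z = k then 0 else Suc (idx z))" using idx_Suc ij(1) by blast
      then show ?thesis using idx_le[of z] by (cases "idx z = k") simp_all
    next
      case 2
      then have "idx z = (if idx w = k then 0 else Suc (idx w))" using idx_Suc ij(2) by blast
      then show ?thesis using idx_le[of w] by (cases "idx w = k") simp_all
    qed
  qed
  have one_shot: "one_shot E (range v) f f'"
    if pq: "cycle_one_shot k p q" "\<And>z. z \<in> range v \<Longrightarrow> f z = p (idx z)"
      "\<And>z. z \<in> range v \<Longrightarrow> f' z = q (idx z)" for f f' p q
  proof -
    obtain \<rho> where \<rho>: "\<And>i. i < k \<Longrightarrow> ranked_edge \<rho> p q i (Suc i)" "ranked_edge \<rho> p q k 0"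
      using pq(1) unfolding cycle_one_shot_def by blast
    have "\<rho> (idx z) < \<rho> (idx w)"
      if zw: "z \<in> range v" "w \<in> range v" "E z w" "p (idx z) = q (idx w)" for z w
      using edge[OF zw(1-3)] \<rho>(1)[of "idx z"] \<rho>(1)[of "idx w"] \<rho>(2) zw(4) unfolding ranked_edge_def by auto
    then show ?thesis
      unfolding one_shot_def using pq(2,3) by (intro exI[of _ "\<rho> \<circ> idx"]) simp
  qed
  have proper: "proper_on E C (range v) (p \<circ> idx)" if "cycle_proper k p" "range p \<subseteq> C" for p
  proof -
    have "p (idx z) \<noteq> p (idx w)" if "z \<in> range v" "w \<in> range v" "E z w" for z w
      using edge[OF that] \<open>cycle_proper k p\<close> unfolding cycle_proper_def by auto
    then show ?thesis using that(2) unfolding proper_on_def by auto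
  qed
  have "one_shot E (range v) \<alpha> (x \<circ> idx)" "one_shot E (range v) (x \<circ> idx) (y \<circ> idx)"
      "one_shot E (range v) (y \<circ> idx) \<beta>"
    by (rule one_shot[OF xy(7)] one_shot[OF xy(8)] one_shot[OF xy(9)]; simp add: v_idx)+
  then have "schedule (range v) (x \<circ> idx) (y \<circ> idx)"
    unfolding schedule_def using proper xy(3-6) by blast
  then show "\<exists>g h. schedule (range v) g h \<and> g (v 0) = c1 \<and> h (v 0) = c2"
    using xy(1,2) by (intro exI[of _ "x \<circ> idx"] exI[of _ "y \<circ> idx"]) (simp add: idx)
qed

text \<open>Walks outside \<open>S\<close> stand in for components: each component of
  \<open>V - S\<close> has at most one neighbor in \<open>S\<close>.\<close>

definition attached :: "'a set \<Rightarrow> bool" where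
  "attached S \<longleftrightarrow> (\<forall>x\<in>S. \<forall>y\<in>S. \<forall>a b. a \<in> V - S \<longrightarrow> b \<in> V - S \<longrightarrow>
     E x a \<longrightarrow> (adj_in E (V - S))\<^sup>*\<^sup>* a b \<longrightarrow> E b y \<longrightarrow> x = y)"

definition good_block :: "'a set \<Rightarrow> 'a \<Rightarrow> bool" where
  "good_block X u \<longleftrightarrow> X \<subseteq> V \<and> nonsep E X \<and>
     (\<forall>Y. nonsep E Y \<longrightarrow> X \<subseteq> Y \<longrightarrow> Y \<subseteq> V \<longrightarrow> Y = X) \<and> extendable X u"

text \<open>The block meets \<open>S\<close> only in \<open>u\<close>, and the rest of it lies in
  the component of \<open>w\<close>, so gluing applies. The invariant survives since two attachments
  in \<open>X\<close> would yield an ear, and any others contradict the old invariant.\<close>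

lemma schedule_grow:
  assumes "S \<subseteq> V" "attached S" "schedule S g h"
    and uw: "u \<in> S" "w \<in> V - S" "E u w"
    and X: "u \<in> X" "w \<in> X" "good_block X u"
  shows "attached (S \<union> X) \<and> (\<exists>g h. schedule (S \<union> X) g h)"
proof -
  have X': "X \<subseteq> V" "nonsep E X" "extendable X u" using X by (auto simp: good_block_def)
  have att: "x = y" if "x \<in> S" "y \<in> S" "a \<in> V - S" "b \<in> V - S" "E x a"
      "(adj_in E (V - S))\<^sup>*\<^sup>* a b" "E b y" for x y a b
    using assms(2) that unfolding attached_def by blast
  have from_w: "z \<in> V - S \<and> (adj_in E (V - S))\<^sup>*\<^sup>* w z" if "z \<in> X - {u}" for z
  proof -
    have "(adj_in E (X - {u}))\<^sup>*\<^sup>* w z"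
      using X X' uw that unfolding nonsep_def conn_def by blast
    then show ?thesis
    proof (induction rule: rtranclp_induct)
      case base
      then show ?case using uw by simp
    next
      case (step z z')
      have "z' \<in> V - S"
      \<comment> \<open>Following \<open>X - {u}\<close> from \<open>w\<close>, a first return to
        \<open>S\<close> at \<open>z'\<close> would be a second attachment of the component of
        \<open>w\<close> besides \<open>u\<close>.\<close>
      proof (rule ccontr)
        assume "z' \<notin> V - S"
        then have "z' \<in> S" using step(2) X' by (auto simp: adj_in_def)
        then have "u = z'"
          using att[of u z' w z] step uw by (auto simp: adj_in_def)
        then show False using step(2) by (auto simp: adj_in_def)
      qed
      then show ?case
        using step by (auto simp: adj_in_def intro: rtranclp.rtrancl_into_rtrancl)
    qed
  qed
  have to_w: "(adj_in E (V - S))\<^sup>*\<^sup>* z w" if "z \<in> X - {u}" for z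
    using from_w[OF that] adj_in_sym[OF sym] by blast
  have X_S: "S \<inter> X = {u}" using from_w X uw by blast
  have root: "s = u" if "s \<in> S" "z \<in> X - {u}" "E z s \<or> E s z" for s z
    using att[of u s w z] that from_w[of z] uw sympD[OF sym] by blast
  have split: "edges_split E S X"
    unfolding edges_split_def
  proof (intro ballI impI)
    fix x y assume xy: "x \<in> S \<union> X" "y \<in> S \<union> X" "E x y"
    show "{x, y} \<subseteq> S \<or> {x, y} \<subseteq> X"
      using root[of x y] root[of y x] xy X(1) uw(1) by blast
  qed
  have "attached (S \<union> X)"
    unfolding attached_def
  proof (intro ballI allI impI)
    fix x y a b
    assume xy: "x \<in> S \<union> X" "y \<in> S \<union> X" and ab: "a \<in> V - (S \<union> X)" "b \<in> V - (S \<union> X)"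
      and reach: "E x a" "(adj_in E (V - (S \<union> X)))\<^sup>*\<^sup>* a b" "E b y"
    have reach': "(adj_in E (V - S))\<^sup>*\<^sup>* a b" "(adj_in E (V - S))\<^sup>*\<^sup>* b a"
      using adj_in_mono[OF reach(2)] adj_in_sym[OF sym] by blast+
    \<comment> \<open>Mixed case: the outside walk continues through \<open>z\<close> to
      \<open>w\<close>, hence lies in the component attached at \<open>u\<close>.\<close>
    have through: "s = u"
      if "s \<in> S" "z \<in> X - {u}" "E s c" "(adj_in E (V - S))\<^sup>*\<^sup>* c d" "E d z"
        "c \<in> V - S" "d \<in> V - S" for s z c d
    proof -
      have "adj_in E (V - S) d z" using that from_w[of z] by (auto simp: adj_in_def)
      then have "(adj_in E (V - S))\<^sup>*\<^sup>* c w"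
        using that(4) to_w[OF that(2)] by (meson rtranclp.rtrancl_into_rtrancl rtranclp_trans)
      then show ?thesis using att[of s u c w] that uw sympD[OF sym] by blast
    qed
    show "x = y"
    proof (cases "x \<in> S \<and> y \<in> S")
      case True
      then show ?thesis using att[of x y a b] reach reach' ab by blast
    next
      case False
      have "x \<in> X"
        using False xy through[of x y a b] reach reach' ab X(1) uw(1) by blast
      moreover have "y \<in> X"
        using False xy through[of y x b a] reach reach' ab X(1) uw(1) sympD[OF sym] by blast
      \<comment> \<open>Two distinct attachments in \<open>X\<close> would give an ear, whose
        addition to \<open>X\<close> contradicts maximality.\<close>
      ultimately show ?thesis
        using nonsep_ear[OF sym X'(2), of x y "V - (S \<union> X)" a b] reach ab X X'(1)
        unfolding good_block_def by blast
    qed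
  qed
  then show ?thesis
    using schedule_extend[OF assms(3) X'(3) split X_S] by blast
qed

text \<open>If a maximal treated set is not \<open>V\<close>, connectedness supplies an edge leaving
  it, and the block of that edge enlarges it.\<close>

theorem schedule_exists:
  assumes "conn E V"
    and blocks: "\<And>u w. u \<in> V \<Longrightarrow> w \<in> V \<Longrightarrow> E u w \<Longrightarrow> \<exists>X. u \<in> X \<and> w \<in> X \<and> good_block X u"
  shows "\<exists>g h. schedule V g h"
proof (cases "V = {}")
  case True
  then show ?thesis by (simp add: schedule_def proper_on_def one_shot_def)
next
  case False
  then obtain r where r: "r \<in> V" by blast
  define F where "F = {S. r \<in> S \<and> S \<subseteq> V \<and> attached S \<and> (\<exists>g h. schedule S g h)}"
  have "{r} \<in> F"
  proof -
    obtain d where "d \<in> C" using ex_color3[OF C] by blast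
    then have "schedule {r} (\<lambda>_. d) (\<lambda>_. d)"
      using irrefl by (auto simp: schedule_def proper_on_def one_shot_def)
    then show ?thesis using r by (auto simp: F_def attached_def)
  qed
  moreover have "finite F"
    using finite by (rule finite_subset[rotated, OF finite_Pow_iff[THEN iffD2]]) (auto simp: F_def)
  ultimately obtain S where S: "S \<in> F" "\<And>T. T \<in> F \<Longrightarrow> S \<subseteq> T \<Longrightarrow> S = T"
    using finite_has_maximal2 by metis
  have "S = V"
  proof (rule ccontr)
    assume "S \<noteq> V"
    then obtain z where z: "z \<in> V" "z \<notin> S" using S by (auto simp: F_def)
    have "(adj_in E V)\<^sup>*\<^sup>* r z" using assms(1) r z by (simp add: conn_def)
    then have "z \<in> S \<or> (\<exists>u w. u \<in> S \<and> w \<in> V - S \<and> E u w)"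
      by (induction rule: rtranclp_induct) (use S in \<open>auto simp: F_def adj_in_def\<close>)
    then obtain u w where uw: "u \<in> S" "w \<in> V - S" "E u w" using z by blast
    obtain X where X: "u \<in> X" "w \<in> X" "good_block X u"
      using blocks[of u w] uw S by (auto simp: F_def)
    obtain g h where "schedule S g h" using S by (auto simp: F_def)
    then have "S \<union> X \<in> F"
      using schedule_grow[OF _ _ _ uw X] S(1) X(3) by (auto simp: F_def good_block_def)
    then show False using S(2) X(2) uw by blast
  qed
  then show ?thesis using S(1) by (auto simp: F_def)
qed

end

section \<open>From schedules to transformations\<close>

lemma wf_reconf_graph: "wf_digraph (reconf_graph l G)"
  by unfold_locales (auto simp: reconf_graph_def)

lemma verts_reconf_graph: "verts (reconf_graph l G) = colorings l G"
  by (simp add: reconf_graph_def)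

lemma times_recolored_append [simp]:
  "times_recolored (p @ q) v = times_recolored p v + times_recolored q v"
  by (simp add: times_recolored_def)

lemma colorings_proper_on:
  assumes "wf_digraph G" "c \<in> colorings l G"
  shows "proper_on (dominates G) {1..l} (verts G) c"
  using assms by (auto simp: colorings_def proper_on_def)

lemma proper_on_colorings:
  assumes "wf_digraph G" "proper_on (dominates G) {1..l} (verts G) c"
  shows "restrict c (verts G) \<in> colorings l G"
proof -
  interpret wf_digraph G by fact
  have "restrict c (verts G) \<in> verts G \<rightarrow>\<^sub>E {1..l}"
    using assms(2) by (auto simp: proper_on_def)
  moreover have "restrict c (verts G) u \<noteq> restrict c (verts G) v" if "u \<rightarrow>\<^bsub>G\<^esub> v" for u v
    using assms(2) that adj_in_verts[OF that] by (simp add: proper_on_def)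
  ultimately show ?thesis by (simp add: colorings_def)
qed

text \<open>Vertices are recolored one by one in the order of their ranks. If the new color of
  \<open>x\<close> were the old color of a neighbor \<open>y\<close> still waiting, then
  \<open>y\<close> would have the smaller rank and would have come first.\<close>

lemma one_shot_awalk:
  assumes "graph G" and f: "f \<in> colorings l G" and f': "f' \<in> colorings l G"
    and "one_shot (dominates G) (verts G) f f'"
  shows "\<exists>p. pre_digraph.awalk (reconf_graph l G) f p f' \<and> (\<forall>v. times_recolored p v \<le> 1)"
proof -
  interpret graph G by fact
  interpret R: wf_digraph "reconf_graph l G" by (rule wf_reconf_graph)
  obtain \<rho> :: "'a \<Rightarrow> int" where
    \<rho>: "\<And>x y. x \<in> verts G \<Longrightarrow> y \<in> verts G \<Longrightarrow> x \<rightarrow>\<^bsub>G\<^esub> y \<Longrightarrow> f x = f' y \<Longrightarrow> \<rho> x < \<rho> y"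
    using assms(4) unfolding one_shot_def by blast
  obtain vs where vs: "set vs = verts G" "distinct vs"
    using finite_distinct_list finite_verts by blast
  define xs where "xs = sort_key \<rho> vs"
  have xs: "set xs = verts G" "distinct xs" "sorted (map \<rho> xs)"
    using vs by (simp_all add: xs_def)
  define mix where "mix U x = (if x \<in> U then f' x else f x)" for U x
  have ext: "f x = undefined" "f' x = undefined" if "x \<notin> verts G" for x
    using f f' PiE_arb[OF _ that] unfolding colorings_def by blast+
  have mix: "mix (set ys) \<in> colorings l G" if split: "xs = ys @ zs" for ys zs
  proof -
    have later: "\<rho> x \<le> \<rho> y" if "x \<in> set ys" "y \<in> set zs" for x y
      using xs(3) that unfolding split by (auto simp: sorted_append)
    have no_conflict: "f' x \<noteq> f y" if "x \<rightarrow>\<^bsub>G\<^esub> y" "x \<in> set ys" "y \<notin> set ys" for x y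
    proof
      assume "f' x = f y"
      moreover have "y \<rightarrow>\<^bsub>G\<^esub> x" using that(1) by (rule graph_symmetric)
      ultimately have "\<rho> y < \<rho> x" using \<rho>[of y x] adj_in_verts[OF that(1)] by simp
      moreover have "y \<in> set zs" using adj_in_verts[OF that(1)] that(3) xs(1) unfolding split by auto
      ultimately show False using later[OF that(2), of y] by linarith
    qed
    have "mix (set ys) x \<noteq> mix (set ys) y" if "x \<rightarrow>\<^bsub>G\<^esub> y" for x y
    proof -
      have yx: "y \<rightarrow>\<^bsub>G\<^esub> x" using that by (rule graph_symmetric)
      have "f x \<noteq> f y" "f' x \<noteq> f' y" using f f' that by (auto simp: colorings_def)
      then show ?thesis
        using no_conflict[OF that] no_conflict[OF yx, THEN not_sym] by (simp add: mix_def)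
    qed
    moreover have "mix (set ys) \<in> verts G \<rightarrow>\<^sub>E {1..l}"
      using f f' by (simp add: colorings_def mix_def PiE_iff extensional_def)
    ultimately show ?thesis by (simp add: colorings_def)
  qed
  have "\<exists>p. R.awalk f p (mix (set ys)) \<and> (\<forall>v. times_recolored p v \<le> (if v \<in> set ys then 1 else 0))"
    if "xs = ys @ zs" for ys zs
    using that
  proof (induction ys arbitrary: zs rule: rev_induct)
    case Nil
    have "mix (set []) = f" by (simp add: mix_def fun_eq_iff)
    then have "R.awalk f [] (mix (set []))"
      using f by (simp add: R.awalk_Nil_iff verts_reconf_graph)
    then show ?case by (intro exI[of _ "[]"]) (simp add: times_recolored_def)
  next
    case (snoc y ys)
    let ?c = "mix (set ys)" and ?d = "mix (set (ys @ [y]))"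
    obtain p where p: "R.awalk f p ?c" "\<forall>v. times_recolored p v \<le> (if v \<in> set ys then 1 else 0)"
      using snoc.IH[of "y # zs"] snoc.prems by auto
    have cd: "?c \<in> colorings l G" "?d \<in> colorings l G"
      using mix[of ys "y # zs"] mix[of "ys @ [y]" zs] snoc.prems by simp_all
    have y: "y \<in> verts G" "y \<notin> set ys" using xs(1,2) snoc.prems by auto
    have diff: "?c v \<noteq> ?d v \<longleftrightarrow> v = y \<and> f y \<noteq> f' y" for v
      using y(2) by (auto simp: mix_def)
    show ?case
    \<comment> \<open>A vertex that keeps its color contributes no arc, since an arc of the
      reconfiguration graph changes exactly one color.\<close>
    proof (cases "f y = f' y")
      case True
      then have "?d = ?c" using diff by (auto simp: fun_eq_iff)
      then have "R.awalk f p ?d" using p(1) by simp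
      moreover have "times_recolored p v \<le> (if v \<in> set (ys @ [y]) then 1 else 0)" for v
        using p(2)[rule_format, of v] by (auto split: if_splits)
      ultimately show ?thesis by blast
    next
      case False
      have "(?c, ?d) \<in> arcs (reconf_graph l G)"
        using cd y(1) diff False by (auto simp: reconf_graph_def)
      then have "R.awalk ?c [(?c, ?d)] ?d"
        using cd by (simp add: R.awalk_Cons_iff R.awalk_Nil_iff verts_reconf_graph)
          (simp add: reconf_graph_def)
      then have "R.awalk f (p @ [(?c, ?d)]) ?d"
        using p(1) by (rule R.awalk_appendI[rotated])
      moreover have "times_recolored (p @ [(?c, ?d)]) v \<le> (if v \<in> set (ys @ [y]) then 1 else 0)" for v
      proof -
        have "times_recolored [(?c, ?d)] v = (if v = y then 1 else 0)"
          using diff[of v] False by (auto simp: times_recolored_def)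
        then show ?thesis using p(2)[rule_format, of v] y(2) by auto
      qed
      ultimately show ?thesis by blast
    qed
  qed
  from this[of xs "[]"] obtain p where p: "R.awalk f p (mix (set xs))"
      "\<forall>v. times_recolored p v \<le> (if v \<in> set xs then 1 else 0)"
    by auto
  have "times_recolored p v \<le> 1" for v
    using p(2)[rule_format, of v] by (simp split: if_splits)
  moreover have "mix (set xs) = f'"
    using ext xs(1) by (auto simp: mix_def fun_eq_iff)
  ultimately show ?thesis using p(1) by auto
qed

text \<open>A transformation repeats no coloring, but joined walks may do so. Cutting out closed
  subwalks only lowers the number of recolorings.\<close>

lemma transformation_if_awalk:
  assumes "pre_digraph.awalk (reconf_graph l G) c p d"
  shows "\<exists>q. transformation l G c q d \<and> (\<forall>v. times_recolored q v \<le> times_recolored p v)"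
  using assms
proof (induction p rule: length_induct)
  case (1 p)
  interpret R: wf_digraph "reconf_graph l G" by (rule wf_reconf_graph)
  show ?case
  proof (cases "distinct (R.awalk_verts c p)")
    case True
    then show ?thesis
      using "1.prems" by (intro exI[of _ p]) (simp add: transformation_def R.apath_def)
  next
    case False
    then obtain q r s w where qrs: "p = q @ r @ s" "0 < length r" "R.awalk c q w" "R.awalk w s d"
      using R.awalk_not_distinct_decomp[OF "1.prems"] by blast
    then have "R.awalk c (q @ s) d" by (intro R.awalk_appendI)
    moreover have "length (q @ s) < length p" using qrs by simp
    ultimately obtain t where t: "transformation l G c t d"
        "\<And>v. times_recolored t v \<le> times_recolored (q @ s) v"
      using "1.IH" by blast
    have "times_recolored t v \<le> times_recolored p v" for v
      using t(2)[of v] by (simp add: qrs(1))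
    then show ?thesis using t(1) by blast
  qed
qed

section \<open>Blocks of a cactus\<close>

lemma conn_singleton: "conn E {x}"
  by (simp add: conn_def)

lemma nonsep_edge:
  assumes "symp E" "E u w"
  shows "nonsep E {u, w}"
proof -
  have "conn E {u, w}"
    using assms by (intro conn_hub[OF assms(1) conn_singleton[of E u]])
      (auto simp: adj_in_def symp_def intro!: r_into_rtranclp)
  moreover have "conn E ({u, w} - {v})" for v
  proof (cases "v \<in> {u, w}")
    case True
    then have "{u, w} - {v} = {} \<or> (\<exists>x. {u, w} - {v} = {x})" by auto
    then show ?thesis by (elim disjE exE) (simp_all add: conn_def)
  next
    case False
    then show ?thesis using \<open>conn E {u, w}\<close> by simp
  qed
  ultimately show ?thesis by (simp add: nonsep_def)
qed

text \<open>A cycle of length \<open>n\<close> as an \<open>n\<close>-periodic sequence; the closing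
  edge is then no special case.\<close>

definition cycle_seq :: "('a \<Rightarrow> 'a \<Rightarrow> bool) \<Rightarrow> nat \<Rightarrow> (nat \<Rightarrow> 'a) \<Rightarrow> bool" where
  "cycle_seq E n v \<longleftrightarrow> 3 \<le> n \<and> (\<forall>i j. v i = v j \<longleftrightarrow> i mod n = j mod n) \<and>
     (\<forall>i. E (v i) (v (Suc i)))"

lemma cycle_seq_shift:
  assumes "cycle_seq E n v"
  shows "cycle_seq E n (\<lambda>i. v (i + s))" and "range (\<lambda>i. v (i + s)) = range v"
proof -
  have n: "3 \<le> n" and period: "\<And>i j. v i = v j \<longleftrightarrow> i mod n = j mod n"
    and adj: "\<And>i. E (v i) (v (Suc i))"
    using assms unfolding cycle_seq_def by blast+
  have "v (i + s) = v (j + s) \<longleftrightarrow> i mod n = j mod n" for i j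
    unfolding period by (simp add: nat_mod_eq_iff)
  moreover have "E (v (i + s)) (v (Suc i + s))" for i
    using adj[of "i + s"] by simp
  ultimately show "cycle_seq E n (\<lambda>i. v (i + s))"
    using n unfolding cycle_seq_def by blast
  have "v i \<in> range (\<lambda>i. v (i + s))" for i
  proof -
    \<comment> \<open>Adding \<open>s * (n - 1)\<close> shifts back by \<open>s\<close> modulo
      \<open>n\<close> without subtracting naturals.\<close>
    have "i + s * (n - 1) + s = i + n * s"
      using n by (cases n) (simp_all add: algebra_simps)
    then have "v i = v (i + s * (n - 1) + s)" by (simp only: period mod_mult_self2)
    then show ?thesis by blast
  qed
  then show "range (\<lambda>i. v (i + s)) = range v" by auto
qed

text \<open>Rotated so that the deleted vertex is at position 0, the rest is the path from position
  1 to \<open>n - 1\<close>.\<close>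

lemma nonsep_cycle:
  assumes "symp E" "cycle_seq E n v"
  shows "nonsep E (range v)"
proof -
  have conn: "conn E (range v)"
  proof (rule conn_hub[OF assms(1) conn_singleton[of E "v 0"]])
    have "(adj_in E (range v))\<^sup>*\<^sup>* (v 0) (v i)" for i
    proof (induction i)
      case (Suc i)
      then show ?case
        using assms(2) by (auto simp: cycle_seq_def adj_in_def intro: rtranclp.rtrancl_into_rtrancl)
    qed simp
    then show "\<exists>x\<in>{v 0}. (adj_in E (range v))\<^sup>*\<^sup>* z x" if "z \<in> range v - {v 0}" for z
      using that adj_in_sym[OF assms(1)] by auto
  qed auto
  moreover have "conn E (range v - {z})" for z
  proof (cases "z \<in> range v")
    case True
    then obtain s where "z = v s" by blast
    define u where "u = (\<lambda>i. v (i + s))"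
    have u: "cycle_seq E n u" "range u = range v" "z = u 0"
      using cycle_seq_shift[OF assms(2), of s] \<open>z = v s\<close> by (simp_all add: u_def)
    have n: "3 \<le> n" and period: "\<And>i j. u i = u j \<longleftrightarrow> i mod n = j mod n" and adj: "\<And>i. E (u i) (u (Suc i))"
      using u(1) by (simp_all add: cycle_seq_def)
    have ne: "u i \<noteq> u 0" if "0 < i" "i < n" for i
      using that by (simp add: period)
    have reach: "(adj_in E (range u - {u 0}))\<^sup>*\<^sup>* (u 1) (u (Suc i))" if "Suc i < n" for i
      using that
    proof (induction i)
      case (Suc i)
      then have "adj_in E (range u - {u 0}) (u (Suc i)) (u (Suc (Suc i)))"
        using adj ne[of "Suc i"] ne[of "Suc (Suc i)"] by (auto simp: adj_in_def)
      then show ?case using Suc by (auto intro: rtranclp.rtrancl_into_rtrancl)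
    qed simp
    have "conn E (range u - {u 0})"
    proof (rule conn_hub[OF assms(1) conn_singleton[of E "u 1"]])
      show "{u 1} \<subseteq> range u - {u 0}" using ne[of 1] n by auto
      fix x assume "x \<in> range u - {u 0} - {u 1}"
      then obtain i where i: "x = u i" "u i \<noteq> u 0" by auto
      then have "i mod n \<noteq> 0" "x = u (i mod n)" by (auto simp: period)
      moreover have "i mod n < n" using n by simp
      ultimately have "(adj_in E (range u - {u 0}))\<^sup>*\<^sup>* (u 1) x"
        using reach[of "i mod n - 1"] by simp
      then show "\<exists>y\<in>{u 1}. (adj_in E (range u - {u 0}))\<^sup>*\<^sup>* x y"
        using adj_in_sym[OF assms(1)] by auto
    qed
    then show ?thesis using u by simp
  qed (use conn in simp)
  ultimately show ?thesis by (simp add: nonsep_def)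
qed

section \<open>Components, induced subgraphs and blocks\<close>

lemma sccs_strongly_connected:
  assumes "wf_digraph H" "strongly_connected H"
  shows "pre_digraph.sccs H = {H}"
proof -
  interpret wf_digraph H by fact
  have "K = H" if "K \<in> sccs" for K
  proof -
    have K: "induced_subgraph K H" "\<not> verts K \<subset> verts H"
      using that assms(2) induced_subgraph_refl by (auto simp: sccs_def)
    then have verts: "verts K = verts H" by (auto simp: induced_subgraph_def subgraph_def)
    then have "arcs K = arcs H" using K(1) by (auto simp: induced_subgraph_def)
    then show ?thesis using K(1) verts
      by (auto simp: induced_subgraph_def subgraph_def compatible_def intro!: pre_digraph.equality)
  qed
  moreover have "H \<in> sccs"
    using assms(2) induced_subgraph_refl by (auto simp: sccs_def induced_subgraph_def subgraph_def)
  ultimately show ?thesis by blast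
qed

context graph
begin

lemma dominates_symp: "symp (dominates G)"
  by (rule sympI) (rule graph_symmetric)

lemma dominates_induce_iff: "u \<rightarrow>\<^bsub>G \<restriction> X\<^esub> v \<longleftrightarrow> u \<rightarrow>\<^bsub>G\<^esub> v \<and> u \<in> X \<and> v \<in> X"
  by (auto simp: arcs_ends_conv)

lemma strongly_connected_induce:
  assumes "conn (dominates G) X" "X \<noteq> {}"
  shows "strongly_connected (G \<restriction> X)"
proof
  interpret X: wf_digraph "G \<restriction> X" by (rule wellformed_induce_subgraph)
  fix u v assume uv: "u \<in> verts (G \<restriction> X)" "v \<in> verts (G \<restriction> X)"
  then have "(adj_in (dominates G) X)\<^sup>*\<^sup>* u v" using assms(1) by (simp add: conn_def)
  then show "u \<rightarrow>\<^sup>*\<^bsub>G \<restriction> X\<^esub> v"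
  proof (induction rule: rtranclp_induct)
    case (step y z)
    then show ?case
      by (auto simp: adj_in_def dominates_induce_iff intro: X.reachable_adj_trans)
  qed (use uv in simp)
qed (use assms in simp)

lemma graph_induce: "X \<subseteq> verts G \<Longrightarrow> graph (G \<restriction> X)"
  using finite_subset[OF _ finite_verts] no_loops no_multi_arcs graph_symmetric
  by unfold_locales (auto simp: symmetric_def sym_def dominates_induce_iff)

abbreviation nonseparable_graph :: "('a, 'b) pre_digraph \<Rightarrow> bool" where
  "nonseparable_graph H \<equiv> graph H \<and> Digraph_Component.connected H \<and> (\<nexists>v. cut_vertex H v)"

text \<open>The subgraph has one component, and deleting a vertex leaves at most one, so the number
  of components never increases.\<close>

lemma nonseparable_induce:
  assumes X: "X \<subseteq> verts G" "X \<noteq> {}" "nonsep (dominates G) X"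
  shows "nonseparable_graph (G \<restriction> X)"
proof -
  interpret X: graph "G \<restriction> X" by (rule graph_induce[OF X(1)])
  have sc: "strongly_connected (G \<restriction> X)"
    using X by (intro strongly_connected_induce) (simp_all add: nonsep_def)
  then have "Digraph_Component.connected (G \<restriction> X)"
    using X.reachable_mk_symmetric_eq[OF X.sym_arcs]
    by (simp add: Digraph_Component.connected_def strongly_connected_def)
  moreover have "\<not> cut_vertex (G \<restriction> X) v" for v
  proof -
    have del: "pre_digraph.del_vert (G \<restriction> X) v = G \<restriction> (X - {v})"
      by (auto simp: pre_digraph.del_vert_def induce_subgraph_def)
    have "card (pre_digraph.sccs (G \<restriction> (X - {v}))) \<le> 1"
    proof (cases "X - {v} = {}")
      case True
      then have "pre_digraph.sccs (G \<restriction> (X - {v})) = {}"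
        by (auto simp: pre_digraph.sccs_def induced_subgraph_def subgraph_def strongly_connected_def)
      then show ?thesis by simp
    next
      case False
      then have "strongly_connected (G \<restriction> (X - {v}))"
        using X(3) by (intro strongly_connected_induce) (simp_all add: nonsep_def)
      then show ?thesis using sccs_strongly_connected[OF wellformed_induce_subgraph] by simp
    qed
    then show ?thesis
      using sccs_strongly_connected[OF wellformed_induce_subgraph sc] by (simp add: cut_vertex_def del)
  qed
  ultimately show ?thesis using X.graph_axioms by blast
qed

text \<open>Among the nonseparable subgraphs containing \<open>u\<close> and \<open>w\<close>, one
  with the most vertices and arcs together is maximal, as every subgraph above it also contains
  \<open>u\<close> and \<open>w\<close>.\<close>

lemma ex_block:
  assumes "u \<rightarrow>\<^bsub>G\<^esub> w"
  shows "\<exists>B. block G B \<and> u \<in> verts B \<and> w \<in> verts B"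
proof -
  have uw: "{u, w} \<subseteq> verts G" using adj_in_verts[OF assms] by simp
  define Q where "Q H \<longleftrightarrow> subgraph H G \<and> nonseparable_graph H \<and> {u, w} \<subseteq> verts H" for H
  have "Q (G \<restriction> {u, w})"
    using nonseparable_induce[OF uw _ nonsep_edge[OF dominates_symp assms]]
      subgraph_induce_subgraphI[OF uw] by (simp add: Q_def)
  moreover have "card (verts H) + card (arcs H) < Suc (card (verts G) + card (arcs G))" if "Q H" for H
    using that card_mono[OF finite_verts, of "verts H"] card_mono[OF finite_arcs, of "arcs H"]
    by (auto simp: Q_def subgraph_def)
  ultimately obtain B where B: "Q B"
      "\<And>H. Q H \<Longrightarrow> card (verts H) + card (arcs H) \<le> card (verts B) + card (arcs B)"
    using ex_has_greatest_nat[of Q _ "\<lambda>H. card (verts H) + card (arcs H)"] by metis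
  have "H = B" if H: "subgraph B H" "subgraph H G" "nonseparable_graph H" for H
  proof -
    have sub: "verts B \<subseteq> verts H" "arcs B \<subseteq> arcs H" "tail B = tail H" "head B = head H"
      using H(1) by (auto simp: subgraph_def compatible_def)
    have fin: "finite (verts H)" "finite (arcs H)"
      using H(2) finite_subset[OF _ finite_verts] finite_subset[OF _ finite_arcs]
      by (auto simp: subgraph_def)
    have "Q H" using B(1) H sub by (auto simp: Q_def)
    then have "card (verts H) = card (verts B)" "card (arcs H) = card (arcs B)"
      using B(2)[of H] card_mono[OF fin(1) sub(1)] card_mono[OF fin(2) sub(2)] by simp_all
    then have "verts B = verts H" "arcs B = arcs H"
      using card_subset_eq fin sub by metis+
    then show ?thesis using sub by simp
  qed
  then have "block G B"
    using B(1) unfolding block_def max_subgraph_def Q_def by blast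
  then show ?thesis using B(1) by (auto simp: Q_def)
qed

text \<open>For nonseparable \<open>Y\<close> above \<open>X\<close>, the subgraph induced by
  \<open>Y\<close> contains \<open>B\<close> and is nonseparable, hence equals \<open>B\<close>. So
  \<open>B\<close> is induced, and maximality passes to vertex sets.\<close>

lemma block_nonsep:
  assumes B: "block G B" and X: "verts B = X" "X \<noteq> {}" "nonsep (dominates G) X"
  shows "B = G \<restriction> X"
    and "nonsep (dominates G) Y \<Longrightarrow> X \<subseteq> Y \<Longrightarrow> Y \<subseteq> verts G \<Longrightarrow> Y = X"
proof -
  have BG: "subgraph B G"
    and max: "\<And>H. subgraph B H \<Longrightarrow> subgraph H G \<Longrightarrow> nonseparable_graph H \<Longrightarrow> H = B"
    using B unfolding block_def max_subgraph_def by blast+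
  have *: "G \<restriction> Y = B" if Y: "nonsep (dominates G) Y" "X \<subseteq> Y" "Y \<subseteq> verts G" for Y
  proof (rule max)
    show "subgraph B (G \<restriction> Y)"
      using BG X(1) Y(2) wellformed_induce_subgraph
      by (auto simp: subgraph_def compatible_def wf_digraph.tail_in_verts wf_digraph.head_in_verts subset_iff)
    show "subgraph (G \<restriction> Y) G" using Y by (intro subgraph_induce_subgraphI)
    show "nonseparable_graph (G \<restriction> Y)" using X Y by (intro nonseparable_induce) auto
  qed
  have "X \<subseteq> verts G" using BG X(1) by (auto simp: subgraph_def)
  then show "B = G \<restriction> X" using *[of X] X by simp
  show "Y = X" if "nonsep (dominates G) Y" "X \<subseteq> Y" "Y \<subseteq> verts G"
    using *[OF that] X(1) by (metis induce_subgraph_verts)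
qed

end

section \<open>Cycle blocks and edge blocks\<close>

context graph
begin

lemma edges_induce: "{a, b} \<in> edges (G \<restriction> X) \<longleftrightarrow> a \<rightarrow>\<^bsub>G\<^esub> b \<and> a \<in> X \<and> b \<in> X"
  using graph_symmetric by (auto simp: edges_def dominates_induce_iff doubleton_eq_iff)

text \<open>A cycle has a distinct vertex list apart from the first entry, that is, the heads of its
  arcs are distinct. The tails are a rotation of the heads, so they are distinct too and enumerate
  the cycle.\<close>

lemma cycle_graph_cycle_seq:
  assumes B: "subgraph B G" and cyc: "cycle_graph B"
  obtains n v where "cycle_seq (dominates G) n v" "range v = verts B"
    "edges B = range (\<lambda>i. {v i, v (Suc i)})"
proof -
  obtain p z where p: "pre_digraph.awalk B z p z" "distinct (tl (pre_digraph.awalk_verts B z p))"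
      "3 \<le> length p" "verts B = tail B ` set p"
      "edges B = (\<lambda>a. {tail B a, head B a}) ` set p"
    using cyc unfolding cycle_graph_def pre_digraph.cycle_def by blast
  interpret B: wf_digraph B using B by (simp add: subgraph_def)
  define n where "n = length p"
  define vs where "vs = map (tail B) p"
  define v where "v i = vs ! (i mod n)" for i
  have n: "3 \<le> n" "length vs = n" "p \<noteq> []"
    using p(3) by (auto simp: n_def vs_def)
  have cas: "B.cas z p z" "set p \<subseteq> arcs B" using p(1) by (auto simp: B.awalk_def)
  have z: "tail B (hd p) = z" "head B (last p) = z"
    using cas(1) n(3) B.awhd_if_cas[OF cas(1)] B.awlast_if_cas[OF cas(1)]
    by (simp_all add: B.awalk_verts_conv hd_map hd_append)
  have walk: "vs @ [z] = z # map (head B) p"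
    using B.awalk_verts_conv[of z p] B.awalk_verts_conv'[OF cas(1)] n(3) z by (simp add: vs_def)
  have "distinct (map (head B) p)"
    using p(2) B.awalk_verts_conv'[OF cas(1)] n(3) by simp
  moreover have "map (head B) p = tl vs @ [z]" "vs = z # tl vs"
    using walk n by (cases vs; simp)+
  ultimately have "distinct vs"
    by (metis distinct1_rotate rotate1.simps(2))
  then have period: "v i = v j \<longleftrightarrow> i mod n = j mod n" for i j
    using n by (simp add: v_def nth_eq_iff_index_eq)
  have "vs ! 0 = z" using \<open>vs = z # tl vs\<close> by (metis nth_Cons_0)
  have arc: "tail B (p ! i) = v i \<and> head B (p ! i) = v (Suc i)" if "i < n" for i
  proof
    show "tail B (p ! i) = v i" using that n by (simp add: v_def vs_def n_def)
    have "head B (p ! i) = (vs @ [z]) ! Suc i"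
      using that by (simp add: walk n_def)
    also have "\<dots> = v (Suc i)"
    proof (cases "Suc i = n")
      case True
      then show ?thesis using n \<open>vs ! 0 = z\<close> by (simp add: v_def nth_append)
    next
      case False
      then show ?thesis using n that by (simp add: v_def nth_append)
    qed
    finally show "head B (p ! i) = v (Suc i)" .
  qed
  have mod: "v i = v (i mod n)" "v (Suc i) = v (Suc (i mod n))" for i
    by (simp_all add: period mod_Suc_eq)
  have lt: "i mod n < n" for i using n by simp
  have "v i \<rightarrow>\<^bsub>G\<^esub> v (Suc i)" for i
  proof -
    have in_set: "p ! (i mod n) \<in> set p" using lt[of i] by (simp add: n_def)
    have "p ! (i mod n) \<in> arcs G" "tail G = tail B" "head G = head B"
      using cas(2) in_set B by (auto simp: subgraph_def compatible_def)
    then have "v (i mod n) \<rightarrow>\<^bsub>G\<^esub> v (Suc (i mod n))"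
      using arc[OF lt[of i]] by (intro dominatesI[of "p ! (i mod n)"]) (simp_all add: arc_to_ends_def)
    then show ?thesis using mod[of i] by simp
  qed
  moreover have "range v = verts B"
  proof -
    have "v i \<in> v ` {..<n}" for i
      using mod(1)[of i] lt[of i] by blast
    then have "range v = v ` {..<n}" by auto
    also have "\<dots> = set vs"
      using n by (auto simp: v_def set_conv_nth)
    finally show ?thesis using p(4) by (simp add: vs_def)
  qed
  moreover have "edges B = range (\<lambda>i. {v i, v (Suc i)})"
  proof -
    have "edges B = (\<lambda>i. {tail B (p ! i), head B (p ! i)}) ` {..<n}"
      unfolding p(5) by (auto simp: n_def set_conv_nth)
    also have "\<dots> = (\<lambda>i. {v i, v (Suc i)}) ` {..<n}"
      using arc by (intro image_cong) auto
    also have "\<dots> = range (\<lambda>i. {v i, v (Suc i)})"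
    proof -
      have "{v i, v (Suc i)} \<in> (\<lambda>i. {v i, v (Suc i)}) ` {..<n}" for i
        using mod[of i] lt[of i] by (intro image_eqI[of _ _ "i mod n"]) auto
      then show ?thesis by auto
    qed
    finally show ?thesis .
  qed
  ultimately show thesis using that n(1) period unfolding cycle_seq_def by blast
qed

lemma good_block_exists:
  assumes "reconf_instance (verts G) (dominates G) C \<alpha> \<beta>"
    and blocks: "\<And>B. block G B \<Longrightarrow> cycle_graph B \<or> edge_graph B"
    and uw: "u \<rightarrow>\<^bsub>G\<^esub> w"
  shows "\<exists>X. u \<in> X \<and> w \<in> X \<and> reconf_instance.good_block (verts G) (dominates G) C \<alpha> \<beta> X u"
proof -
  interpret R: reconf_instance "verts G" "dominates G" C \<alpha> \<beta> by fact
  obtain B where B: "block G B" "u \<in> verts B" "w \<in> verts B"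
    using ex_block[OF uw] by blast
  have BG: "subgraph B G" using B(1) by (simp add: block_def max_subgraph_def)
  have V: "verts B \<subseteq> verts G" using BG by (simp add: subgraph_def)
  have "nonsep (dominates G) (verts B) \<and> R.extendable (verts B) u"
    using blocks[OF B(1)]
  proof
    assume "edge_graph B"
    moreover have "u \<noteq> w" using uw adj_not_same by blast
    ultimately have "verts B = {u, w}"
      using B(2,3) unfolding edge_graph_def by (elim exE conjE) auto
    then show ?thesis
      using nonsep_edge[OF dominates_symp uw] R.extendable_edge[of u w] adj_in_verts[OF uw] uw by simp
  next
    assume "cycle_graph B"
    then obtain n v where v: "cycle_seq (dominates G) n v" "range v = verts B"
        "edges B = range (\<lambda>i. {v i, v (Suc i)})"
      using cycle_graph_cycle_seq[OF BG] by blast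
    have nonsep: "nonsep (dominates G) (verts B)"
      using nonsep_cycle[OF dominates_symp v(1)] v(2) by simp
    \<comment> \<open>As \<open>B\<close> is induced, every edge of \<open>G\<close> between two of
      its vertices belongs to the cycle; hence there are no chords.\<close>
    have "B = G \<restriction> verts B"
      using block_nonsep(1)[OF B(1) refl _ nonsep] B(2) by blast
    then have edges_B: "edges B = edges (G \<restriction> verts B)" by (rule arg_cong)
    obtain s where s: "u = v s" using B(2) v(2) by blast
    \<comment> \<open>Rotation puts \<open>u\<close> at position 0, the one with prescribed
      colors.\<close>
    define v' where "v' = (\<lambda>i. v (i + s))"
    have v': "cycle_seq (dominates G) n v'" "range v' = verts B" "v' 0 = u"
      using cycle_seq_shift[OF v(1), of s] v(2) s by (simp_all add: v'_def)
    have period: "v i = v j \<longleftrightarrow> i mod n = j mod n" for i j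
      using v(1) by (simp add: cycle_seq_def)
    have next_v: "v (Suc i) = v (Suc j)" if "v i = v j" for i j
      using that unfolding period by (metis mod_Suc_eq)
    have chordless: "v j = v (Suc i) \<or> v i = v (Suc j)" if "v i \<rightarrow>\<^bsub>G\<^esub> v j" for i j
    proof -
      have "v i \<in> verts B" "v j \<in> verts B" using v(2) by auto
      then have "{v i, v j} \<in> edges B"
        using that unfolding edges_B edges_induce by blast
      then obtain m where "{v i, v j} = {v m, v (Suc m)}"
        unfolding v(3) by blast
      then show ?thesis
        using next_v[of i m] next_v[of j m] by (auto simp: doubleton_eq_iff)
    qed
    have "R.extendable (range v') (v' 0)"
    proof (rule R.extendable_cycle[of "n - 1"])
      have n: "Suc (n - 1) = n" "3 \<le> n" using v(1) by (simp_all add: cycle_seq_def)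
      show "2 \<le> n - 1" using n by simp
      show "v' i = v' j \<longleftrightarrow> i mod Suc (n - 1) = j mod Suc (n - 1)" for i j
        using v'(1) unfolding n(1) by (simp add: cycle_seq_def)
      show "range v' \<subseteq> verts G" using v'(2) V by simp
      show "v' i \<rightarrow>\<^bsub>G\<^esub> v' (Suc i)" for i
        using v'(1) by (simp add: cycle_seq_def)
      show "v' j = v' (Suc i) \<or> v' i = v' (Suc j)" if "v' i \<rightarrow>\<^bsub>G\<^esub> v' j" for i j
        using chordless[of "i + s" "j + s"] that by (simp add: v'_def)
    qed
    then show ?thesis using nonsep v' by simp
  qed
  then have nonsep: "nonsep (dominates G) (verts B)" and ext: "R.extendable (verts B) u" by blast+
  have "verts B \<noteq> {}" using B(2) by blast
  then have "Y = verts B" if "nonsep (dominates G) Y" "verts B \<subseteq> Y" "Y \<subseteq> verts G" for Y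
    using block_nonsep(2)[OF B(1) refl _ nonsep that] by blast
  then have "R.good_block (verts B) u"
    using V nonsep ext unfolding R.good_block_def by blast
  then show ?thesis using B(2,3) by blast
qed

end

theorem theorem1p3:
  fixes G :: "('a, 'b) pre_digraph" and l :: nat and \<alpha> \<beta> :: "'a \<Rightarrow> nat"
  assumes "cactus G"
    and "l \<ge> 4"
    and "\<alpha> \<in> colorings l G"
    and "\<beta> \<in> colorings l G"
  shows "\<exists>p. transformation l G \<alpha> p \<beta> \<and> (\<forall>v \<in> verts G. times_recolored p v \<le> 3)"
proof -
  interpret graph G using assms(1) by (simp add: cactus_def)
  interpret W: wf_digraph "reconf_graph l G" by (rule wf_reconf_graph)
  have wf: "wf_digraph G" ..
  have inst: "reconf_instance (verts G) (dominates G) {1..l} \<alpha> \<beta>"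
    using assms dominates_symp colorings_proper_on[OF wf] adj_not_same
    by unfold_locales auto
  interpret R: reconf_instance "verts G" "dominates G" "{1..l}" \<alpha> \<beta> by (rule inst)
  have "conn (dominates G) (verts G)"
    unfolding conn_def
  proof (intro ballI)
    fix u v assume "u \<in> verts G" "v \<in> verts G"
    then have "u \<rightarrow>\<^sup>*\<^bsub>G\<^esub> v"
      using assms(1) reachable_mk_symmetric_eq[OF sym_arcs]
      by (simp add: cactus_def Digraph_Component.connected_def strongly_connected_def)
    then show "(adj_in (dominates G) (verts G))\<^sup>*\<^sup>* u v"
    proof (induction rule: reachable_induct)
      case (step x y)
      then have "adj_in (dominates G) (verts G) x y"
        using adj_in_verts[of x y] by (simp add: adj_in_def)
      then show ?case using step(3) by (rule rtranclp.rtrancl_into_rtrancl[rotated])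
    qed simp
  qed
  then obtain g h where gh: "R.schedule (verts G) g h"
    using R.schedule_exists good_block_exists[OF inst] assms(1) unfolding cactus_def by blast
  \<comment> \<open>Colorings are extensional, so values outside the vertex set are
    discarded.\<close>
  define g' h' where "g' = restrict g (verts G)" and "h' = restrict h (verts G)"
  have "R.schedule (verts G) g' h'"
    using gh R.schedule_cong[of "verts G" g g' h h'] by (simp add: g'_def h'_def)
  moreover have col: "g' \<in> colorings l G" "h' \<in> colorings l G"
    using gh unfolding g'_def h'_def R.schedule_def by (simp_all add: proper_on_colorings[OF wf])
  ultimately have one_shot: "one_shot (dominates G) (verts G) \<alpha> g'"
      "one_shot (dominates G) (verts G) g' h'" "one_shot (dominates G) (verts G) h' \<beta>"
    unfolding R.schedule_def by blast+
  obtain p where p: "W.awalk \<alpha> p g'" "\<And>v. times_recolored p v \<le> 1"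
    using one_shot_awalk[OF graph_axioms assms(3) col(1) one_shot(1)] by blast
  obtain q where q: "W.awalk g' q h'" "\<And>v. times_recolored q v \<le> 1"
    using one_shot_awalk[OF graph_axioms col one_shot(2)] by blast
  obtain r where r: "W.awalk h' r \<beta>" "\<And>v. times_recolored r v \<le> 1"
    using one_shot_awalk[OF graph_axioms col(2) assms(4) one_shot(3)] by blast
  have "W.awalk \<alpha> (p @ q @ r) \<beta>"
    using p(1) q(1) r(1) by (intro W.awalk_appendI)
  then obtain t where t: "transformation l G \<alpha> t \<beta>"
      "\<And>v. times_recolored t v \<le> times_recolored (p @ q @ r) v"
    using transformation_if_awalk by blast
  have "times_recolored t v \<le> 3" for v
    using t(2)[of v] p(2)[of v] q(2)[of v] r(2)[of v] by simp
  then show ?thesis using t(1) by blast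
qed

end
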